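(* Fix $h>0$, $\lambda>0$ and $\sigma>\frac32$, and set $$Z_h=\int_0^he^{-(h-r)(\partial_x^3+\lambda)}\Phi\,\mathrm dW(r).$$ Assume that $Z_h$ is $H^\sigma$-valued and satisfies the nondegeneracy condition $$\inf_{x\in\mathbb T}\mathbb E[|\partial_xZ_h(x)|^2]>0 .$$ Then, with probability one, the Airy--Burgers Lie--Trotter composition with step size $h$ (started from an $H^\sigma$-valued $\mathcal F_0$-measurable state) breaks down after finitely many steps: a Burgers step has no classical $H^\sigma$-solution on its prescribed time interval of length $h$. In particular, the composition does not define an $H^\sigma$-valued approximation for arbitrarily many steps.
   Context: $\mathbb T=\mathbb R/(2\pi\mathbb Z)$; $H^\sigma=H^\sigma(\mathbb T;\mathbb R)$ is the periodic Sobolev space. $(\Omega,\mathcal F,(\mathcal F_t)_{t\ge0},\mathbb P)$ is a filtered probability space satisfying the usual conditions, $W$ is a cylindrical Wiener process on a separable Hilbert space $\mathfrak U$, and $\Phi$ is a deterministic Hilbert--Schmidt noise operator from $\mathfrak U$ into a periodic Sobolev space. The Airy--Burgers Lie--Trotter composition: each time step consists of two parts. (1) A stochastic Airy--damping step of length $h$: started at time $t=Nh$ from the $\mathcal F_t$-measurable $H^\sigma$-valued state $V$, it outputs $$f=e^{-h(\partial_x^3+\lambda)}V+\int_t^{t+h}e^{-(t+h-r)(\partial_x^3+\lambda)}\Phi\,\mathrm dW(r).$$ (2) A Burgers step of length $h$: solve $\partial_tv+v\partial_xv=0$ with $v(0)=f$ classically in $H^\sigma$ on $[0,h]$, and output $v(h)$,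 which is the input of the next time step. A classical $H^\sigma$-solution on $[0,h]$ exists exactly for $f$ in $$D_h=\{f\in H^\sigma:\inf_{x\in\mathbb T}f'(x)>-h^{-1}\}.$$ A step can be completed iff $f\in D_h$; otherwise the composition breaks down at that step. *)

theory Defs
  imports "HOL-Probability.Probability"
begin

section \<open>Periodic Sobolev spaces\<close>

text \<open>A real periodic distribution on \<open>\<real> / 2\<pi>\<int>\<close> is identified with the sequence of its Fourier
  coefficients. This covers Sobolev spaces of every real order, including negative ones.\<close>

type_synonym coeffs = "int \<Rightarrow> complex"

definition sobolev_weight :: "real \<Rightarrow> int \<Rightarrow> real" where
  "sobolev_weight s k = (1 + (real_of_int k)\<^sup>2) powr s"

definition sobolev_space :: "real \<Rightarrow> coeffs set" where
  "sobolev_space s = {a. (\<forall>k. a (- k) = cnj (a k)) \<and>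
     (\<lambda>k. sobolev_weight s k * (cmod (a k))\<^sup>2) summable_on UNIV}"

definition sobolev_norm :: "real \<Rightarrow> coeffs \<Rightarrow> real" where
  "sobolev_norm s a = sqrt (\<Sum>\<^sub>\<infinity>k. sobolev_weight s k * (cmod (a k))\<^sup>2)"

definition sobolev_dist :: "real \<Rightarrow> coeffs \<Rightarrow> coeffs \<Rightarrow> real" where
  "sobolev_dist s a b = sobolev_norm s (\<lambda>k. a k - b k)"

lemma sobolev_weight_nonneg [simp]: "0 \<le> sobolev_weight s k"
  by (simp add: sobolev_weight_def)

lemma sobolev_weight_pos: "0 < sobolev_weight s k"
proof -
  have "0 < 1 + (real_of_int k)\<^sup>2"
    by (simp add: add_pos_nonneg)
  then show ?thesis
    by (simp add: sobolev_weight_def)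
qed

lemma sobolev_norm_nonneg [simp]: "0 \<le> sobolev_norm s a"
  by (auto simp: sobolev_norm_def intro!: infsum_nonneg)

lemma sobolev_space_uminus:
  assumes "a \<in> sobolev_space s"
  shows "(\<lambda>k. - a k) \<in> sobolev_space s"
  using assms by (simp add: sobolev_space_def)

lemma
  assumes a: "a \<in> sobolev_space s" and b: "b \<in> sobolev_space s"
  shows sobolev_space_add: "(\<lambda>k. a k + b k) \<in> sobolev_space s"
    and sobolev_norm_triangle:
      "sobolev_norm s (\<lambda>k. a k + b k) \<le> sobolev_norm s a + sobolev_norm s b"
proof -
  define g where "g c k = sqrt (sobolev_weight s k) * cmod (c k)" for c :: coeffs and k
  have g2: "(g c k)\<^sup>2 = sobolev_weight s k * (cmod (c k))\<^sup>2" for c k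
    by (simp add: g_def power_mult_distrib)
  have L2: "L2_set (g c) A \<le> sobolev_norm s c" if "c \<in> sobolev_space s" "finite A" for c A
    using that unfolding L2_set_def sobolev_norm_def g2 sobolev_space_def
    by (intro real_sqrt_le_mono finite_sum_le_infsum) auto
  have fin: "(\<Sum>k\<in>A. sobolev_weight s k * (cmod (a k + b k))\<^sup>2)
      \<le> (sobolev_norm s a + sobolev_norm s b)\<^sup>2" if A: "finite A" for A
  proof -
    have "(\<Sum>k\<in>A. sobolev_weight s k * (cmod (a k + b k))\<^sup>2)
        \<le> (\<Sum>k\<in>A. (g a k + g b k)\<^sup>2)"
    proof (rule sum_mono)
      fix k
      have "g (\<lambda>k. a k + b k) k \<le> g a k + g b k"
        unfolding g_def distrib_left[symmetric] by (intro mult_left_mono norm_triangle_ineq) simp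
      moreover have "0 \<le> g (\<lambda>k. a k + b k) k"
        by (simp add: g_def)
      ultimately show "sobolev_weight s k * (cmod (a k + b k))\<^sup>2 \<le> (g a k + g b k)\<^sup>2"
        unfolding g2[of "\<lambda>k. a k + b k" k, symmetric] by (rule power_mono)
    qed
    also have "\<dots> = (L2_set (\<lambda>k. g a k + g b k) A)\<^sup>2"
      by (simp add: L2_set_def sum_nonneg)
    also have "\<dots> \<le> (sobolev_norm s a + sobolev_norm s b)\<^sup>2"
      using L2_set_triangle_ineq[of "g a" "g b" A] L2[OF a A] L2[OF b A]
      by (intro power_mono) (auto simp: L2_set_nonneg)
    finally show ?thesis .
  qed
  have sm: "(\<lambda>k. sobolev_weight s k * (cmod (a k + b k))\<^sup>2) summable_on UNIV"
    by (rule nonneg_bdd_above_summable_on) (auto intro!: bdd_aboveI fin)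
  then show "(\<lambda>k. a k + b k) \<in> sobolev_space s"
    using a b by (simp add: sobolev_space_def)
  have "(\<Sum>\<^sub>\<infinity>k. sobolev_weight s k * (cmod (a k + b k))\<^sup>2)
      \<le> (sobolev_norm s a + sobolev_norm s b)\<^sup>2"
    by (rule infsum_le_finite_sums[OF sm]) (auto intro: fin)
  then show "sobolev_norm s (\<lambda>k. a k + b k) \<le> sobolev_norm s a + sobolev_norm s b"
    unfolding sobolev_norm_def[of s "\<lambda>k. a k + b k"]
    by (intro real_le_lsqrt) auto
qed

lemma sobolev_space_diff:
  assumes "a \<in> sobolev_space s" "b \<in> sobolev_space s"
  shows "(\<lambda>k. a k - b k) \<in> sobolev_space s"
  using sobolev_space_add[OF assms(1) sobolev_space_uminus[OF assms(2)]] by simp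

lemma Metric_space_sobolev: "Metric_space (sobolev_space s) (sobolev_dist s)"
proof
  show "0 \<le> sobolev_dist s x y" for x y
    by (simp add: sobolev_dist_def)
  show "sobolev_dist s x y = sobolev_dist s y x" for x y
    by (simp add: sobolev_dist_def sobolev_norm_def norm_minus_commute)
  show "sobolev_dist s x y = 0 \<longleftrightarrow> x = y" if "x \<in> sobolev_space s" "y \<in> sobolev_space s" for x y
  proof
    assume "sobolev_dist s x y = 0"
    then have 0: "(\<Sum>\<^sub>\<infinity>k. sobolev_weight s k * (cmod (x k - y k))\<^sup>2) \<le> 0"
      by (simp add: sobolev_dist_def sobolev_norm_def)
    have sm: "(\<lambda>k. sobolev_weight s k * (cmod (x k - y k))\<^sup>2) summable_on UNIV"
      using sobolev_space_diff[OF that] by (simp add: sobolev_space_def)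
    have "sobolev_weight s k * (cmod (x k - y k))\<^sup>2 = 0" for k
      by (rule nonneg_infsum_le_0D[OF 0 sm]) auto
    moreover have "sobolev_weight s k \<noteq> 0" for k
      using sobolev_weight_pos[of s k] by simp
    ultimately have "x k = y k" for k
      by simp
    then show "x = y" ..
  qed (simp add: sobolev_dist_def sobolev_norm_def)
  show "sobolev_dist s x z \<le> sobolev_dist s x y + sobolev_dist s y z"
    if "x \<in> sobolev_space s" "y \<in> sobolev_space s" "z \<in> sobolev_space s" for x y z
    using sobolev_norm_triangle[OF sobolev_space_diff[OF that(1,2)] sobolev_space_diff[OF that(2,3)]]
    by (simp add: sobolev_dist_def)
qed

definition sobolev_topology :: "real \<Rightarrow> coeffs topology" where
  "sobolev_topology s = Metric_space.mtopology (sobolev_space s) (sobolev_dist s)"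

definition sobolev_borel :: "real \<Rightarrow> coeffs measure" where
  "sobolev_borel s = sigma (sobolev_space s) {U. openin (sobolev_topology s) U}"

text \<open>For members of a Sobolev space of order greater than \<open>1/2\<close> the Fourier series converges
  absolutely and its sum is the continuous representative (already real-valued there, so that
  \<^const>\<open>Re\<close> only adjusts the type).\<close>

definition fourier_fun :: "coeffs \<Rightarrow> real \<Rightarrow> real" where
  "fourier_fun a x = Re (\<Sum>\<^sub>\<infinity>k. a k * cis (real_of_int k * x))"


section \<open>Stochastic framework\<close>

text \<open>Filtrations are indexed by real times; only times \<open>t \<ge> 0\<close> matter. The last clause says that the
  probability space is complete and that \<open>F 0\<close> contains all its null sets.\<close>

definition usual_filtered_prob_space :: "'w measure \<Rightarrow> (real \<Rightarrow> 'w measure) \<Rightarrow> bool" where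
  "usual_filtered_prob_space M F \<longleftrightarrow>
     prob_space M \<and>
     (\<forall>t\<ge>0. subalgebra M (F t)) \<and>
     (\<forall>s t. 0 \<le> s \<and> s \<le> t \<longrightarrow> sets (F s) \<subseteq> sets (F t)) \<and>
     (\<forall>t\<ge>0. sets (F t) = (\<Inter>s\<in>{t<..}. sets (F s))) \<and>
     (\<forall>N\<in>null_sets M. \<forall>A\<subseteq>N. A \<in> sets (F 0))"

definition brownian_motion ::
  "'w measure \<Rightarrow> (real \<Rightarrow> 'w measure) \<Rightarrow> real \<Rightarrow> (real \<Rightarrow> 'w \<Rightarrow> real) \<Rightarrow> bool" where
  "brownian_motion M F c X \<longleftrightarrow>
     (\<forall>t\<ge>0. X t \<in> borel_measurable (F t)) \<and>
     (AE \<omega> in M. X 0 \<omega> = 0) \<and>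
     (AE \<omega> in M. continuous_on {0..} (\<lambda>t. X t \<omega>)) \<and>
     (\<forall>s t. 0 \<le> s \<and> s < t \<longrightarrow>
        prob_space.indep_set M (sets (F s))
          {(\<lambda>\<omega>. X t \<omega> - X s \<omega>) -` A \<inter> space M | A. A \<in> sets borel} \<and>
        distributed M lborel (\<lambda>\<omega>. X t \<omega> - X s \<omega>) (normal_density 0 (c * sqrt (t - s))))"

text \<open>\<open>W t u\<close> plays the role of \<open>\<langle>W(t), u\<rangle>\<close>. The case \<open>u = 0\<close> is covered by linearity.\<close>

definition cylindrical_wiener ::
  "'w measure \<Rightarrow> (real \<Rightarrow> 'w measure) \<Rightarrow> (real \<Rightarrow> 'u::real_inner \<Rightarrow> 'w \<Rightarrow> real) \<Rightarrow> bool" where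
  "cylindrical_wiener M F W \<longleftrightarrow>
     (\<forall>u. u \<noteq> 0 \<longrightarrow> brownian_motion M F (norm u) (\<lambda>t. W t u)) \<and>
     (\<forall>t\<ge>0. \<forall>c u v. AE \<omega> in M. W t (c *\<^sub>R u + v) \<omega> = c * W t u \<omega> + W t v \<omega>)"


section \<open>Hilbert--Schmidt operators into Sobolev spaces\<close>

definition orthonormal_basis :: "'u::real_inner set \<Rightarrow> bool" where
  "orthonormal_basis E \<longleftrightarrow>
     pairwise orthogonal E \<and> (\<forall>e\<in>E. norm e = 1) \<and> closure (span E) = UNIV"

text \<open>For bounded linear \<open>T\<close> the sum is the same for all orthonormal bases, so that the infimum
  just avoids choosing one.\<close>

definition hs_norm_sq :: "real \<Rightarrow> ('u::real_inner \<Rightarrow> coeffs) \<Rightarrow> ennreal" where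
  "hs_norm_sq s T =
     (INF E\<in>{E. orthonormal_basis E}. \<integral>\<^sup>+e. ennreal ((sobolev_norm s (T e))\<^sup>2) \<partial>count_space E)"

definition hilbert_schmidt :: "real \<Rightarrow> ('u::real_inner \<Rightarrow> coeffs) \<Rightarrow> bool" where
  "hilbert_schmidt s T \<longleftrightarrow>
     (\<forall>u. T u \<in> sobolev_space s) \<and>
     (\<forall>c u v k. T (c *\<^sub>R u + v) k = of_real c * T u k + T v k) \<and>
     (\<exists>C. \<forall>u. sobolev_norm s (T u) \<le> C * norm u) \<and>
     hs_norm_sq s T < \<infinity>"


section \<open>Stochastic integrals of deterministic integrands\<close>

text \<open>The list \<open>[(r\<^sub>1, r\<^sub>1', u\<^sub>1, x\<^sub>1), \<dots>]\<close> encodes the operator-valued finite-rank step function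
  \<open>r \<mapsto> \<Sum>\<^sub>i 1\<^bsub>(r\<^sub>i, r\<^sub>i']\<^esub>(r) \<langle>\<cdot>, u\<^sub>i\<rangle> x\<^sub>i\<close>.\<close>

type_synonym 'u step_integrand = "(real \<times> real \<times> 'u \<times> coeffs) list"

definition step_integrand :: "real \<Rightarrow> real \<Rightarrow> real \<Rightarrow> 'u step_integrand \<Rightarrow> bool" where
  "step_integrand s a b G \<longleftrightarrow>
     (\<forall>(r, r', u, x) \<in> set G. a \<le> r \<and> r \<le> r' \<and> r' \<le> b \<and> x \<in> sobolev_space s)"

definition step_op :: "'u::real_inner step_integrand \<Rightarrow> real \<Rightarrow> 'u \<Rightarrow> coeffs" where
  "step_op G q v k =
     (\<Sum>(r, r', u, x)\<leftarrow>G. of_real (indicator {r<..r'} q * (v \<bullet> u)) * x k)"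

definition step_integral ::
  "(real \<Rightarrow> 'u \<Rightarrow> 'w \<Rightarrow> real) \<Rightarrow> 'u step_integrand \<Rightarrow> 'w \<Rightarrow> coeffs" where
  "step_integral W G \<omega> k = (\<Sum>(r, r', u, x)\<leftarrow>G. of_real (W r' u \<omega> - W r u \<omega>) * x k)"

text \<open>\<open>I\<close> is a version of \<open>\<integral>\<^sub>a\<^sup>b B(r) dW(r)\<close>: the limit in \<open>L\<^sup>2(\<Omega>; H\<^sup>s)\<close> of integrals of step functions
  approximating \<open>B\<close> in the Hilbert--Schmidt norm, square-integrated in time. By the Ito isometry such
  a limit is unique up to null sets.\<close>

definition is_stochastic_integral ::
  "'w measure \<Rightarrow> (real \<Rightarrow> 'u::real_inner \<Rightarrow> 'w \<Rightarrow> real) \<Rightarrow> real \<Rightarrow> real \<Rightarrow> real \<Rightarrow>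
   (real \<Rightarrow> 'u \<Rightarrow> coeffs) \<Rightarrow> ('w \<Rightarrow> coeffs) \<Rightarrow> bool" where
  "is_stochastic_integral M W s a b B I \<longleftrightarrow>
     I \<in> M \<rightarrow>\<^sub>M sobolev_borel s \<and>
     (\<exists>G :: nat \<Rightarrow> 'u step_integrand.
        (\<forall>n. step_integrand s a b (G n)) \<and>
        (\<lambda>n. \<integral>\<^sup>+r\<in>{a..b}. hs_norm_sq s (\<lambda>u k. step_op (G n) r u k - B r u k) \<partial>lborel)
          \<longlonglongrightarrow> 0 \<and>
        (\<lambda>n. \<integral>\<^sup>+\<omega>. ennreal ((sobolev_dist s (step_integral W (G n) \<omega>) (I \<omega>))\<^sup>2) \<partial>M)
          \<longlonglongrightarrow> 0)"


section \<open>The Airy--Burgers Lie--Trotter composition\<close>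

text \<open>The semigroup \<open>exp (- t (\<partial>\<^sub>x\<^sup>3 + lam))\<close> as a Fourier multiplier.\<close>

definition airy_semigroup :: "real \<Rightarrow> real \<Rightarrow> coeffs \<Rightarrow> coeffs" where
  "airy_semigroup lam t a k =
     exp (- of_real t * ((\<i> * of_int k) ^ 3 + of_real lam)) * a k"

definition is_airy_convolution ::
  "'w measure \<Rightarrow> (real \<Rightarrow> 'u::real_inner \<Rightarrow> 'w \<Rightarrow> real) \<Rightarrow> real \<Rightarrow> real \<Rightarrow> ('u \<Rightarrow> coeffs) \<Rightarrow>
   real \<Rightarrow> real \<Rightarrow> ('w \<Rightarrow> coeffs) \<Rightarrow> bool" where
  "is_airy_convolution M W s lam \<Phi> t h Z \<longleftrightarrow>
     is_stochastic_integral M W s t (t + h) (\<lambda>r u. airy_semigroup lam (t + h - r) (\<Phi> u)) Z"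

text \<open>\<open>v\<close> belongs to \<open>C([0,h]; H\<^sup>\<sigma>)\<close> and satisfies \<open>\<partial>\<^sub>t v + v \<partial>\<^sub>x v = 0\<close> pointwise, with one-sided time
  derivatives at the endpoints.\<close>

definition burgers_solution ::
  "real \<Rightarrow> real \<Rightarrow> coeffs \<Rightarrow> (real \<Rightarrow> coeffs) \<Rightarrow> bool" where
  "burgers_solution \<sigma> h f v \<longleftrightarrow>
     continuous_map (top_of_set {0..h}) (sobolev_topology \<sigma>) v \<and>
     v 0 = f \<and>
     (\<forall>t\<in>{0..h}. \<forall>x. \<exists>vt vx.
        ((\<lambda>r. fourier_fun (v r) x) has_real_derivative vt) (at t within {0..h}) \<and>
        (fourier_fun (v t) has_real_derivative vx) (at x) \<and>
        vt + fourier_fun (v t) x * vx = 0)"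

text \<open>Solutions are unique only on \<open>[0,h]\<close>, hence \<open>THE\<close> ranges over the terminal value.\<close>

definition burgers_step :: "real \<Rightarrow> real \<Rightarrow> coeffs \<Rightarrow> coeffs option" where
  "burgers_step \<sigma> h f =
     (if \<exists>v. burgers_solution \<sigma> h f v
      then Some (THE g. \<exists>v. burgers_solution \<sigma> h f v \<and> v h = g) else None)"

definition airy_step :: "real \<Rightarrow> real \<Rightarrow> coeffs \<Rightarrow> coeffs \<Rightarrow> coeffs" where
  "airy_step lam h z V k = airy_semigroup lam h V k + z k"

text \<open>The state after \<open>N\<close> complete steps along a noise path \<open>z\<close>, where \<open>z N\<close> is the stochastic
  convolution over \<open>[Nh, (N+1)h]\<close>; \<open>None\<close> means that the composition has broken down before.\<close>

primrec lie_trotter ::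
  "real \<Rightarrow> real \<Rightarrow> real \<Rightarrow> (nat \<Rightarrow> coeffs) \<Rightarrow> coeffs \<Rightarrow> nat \<Rightarrow> coeffs option" where
  "lie_trotter \<sigma> h lam z V0 0 = Some V0"
| "lie_trotter \<sigma> h lam z V0 (Suc N) =
     (case lie_trotter \<sigma> h lam z V0 N of
        None \<Rightarrow> None
      | Some V \<Rightarrow> burgers_step \<sigma> h (airy_step lam h (z N) V))"

definition breaks_down_at ::
  "real \<Rightarrow> real \<Rightarrow> real \<Rightarrow> (nat \<Rightarrow> coeffs) \<Rightarrow> coeffs \<Rightarrow> nat \<Rightarrow> bool" where
  "breaks_down_at \<sigma> h lam z V0 N \<longleftrightarrow>
     (\<exists>V. lie_trotter \<sigma> h lam z V0 N = Some V \<and>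
        \<not> (\<exists>v. burgers_solution \<sigma> h (airy_step lam h (z N) V) v))"

end

theory Submission
  imports Defs
begin

text \<open>A classical Burgers solution on \<open>[0,h]\<close> with initial value \<open>f\<close> is constant along the lines
  \<open>t \<mapsto> y + t f(y)\<close>. These cannot cross, so \<open>x + h f(x)\<close> and \<open>x - h v(h,x)\<close> are both increasing, and
  the derivatives of \<open>f\<close> and \<open>- v(h)\<close> are at least \<open>- 1/h\<close>. As a function of mean zero bounded
  below by \<open>- 1/h\<close> has Fourier coefficients of modulus at most \<open>1/h\<close>, a composition that survives forever
  satisfies \<open>\<bar>z\<^sub>N(k)\<bar> \<le> 2/h\<close> for every mode \<open>k \<noteq> 0\<close> of every noise increment \<open>z\<^sub>N\<close> with \<open>N \<ge> 1\<close>.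
  This condition does not involve the state of the composition, so that no measurability of the
  Burgers flow is needed. By nondegeneracy some real functional of some mode \<open>k \<noteq> 0\<close> of the noise is
  not almost surely zero. Its values on the successive increments are independent centred Gaussians
  whose variances stay away from zero, hence almost surely unbounded.\<close>

section \<open>Absolutely convergent Fourier series\<close>

text \<open>Single modes are compared because the noise enters them additively and the Airy flow
  only rotates and damps them; the nonlinear Burgers flow is used solely through bounds on its input
  and output. Those bounds come from derivatives, which do not see mode 0, and they say nothing
  about the initial state, which is no output of a Burgers step.

  The stochastic obstacle is that an increment is given only as an L2 limit of step integrals,
  measurable for the whole space. Its Gaussian law and its independence of the past are therefore
  carried by one identity, E[1_A exp(i theta eta)] = P(A) exp(- theta^2 V / 2) for all past events
  A. It is proved for step integrands one grid cell after another, and it survives almost sure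
  limits by dominated convergence. The variance V is never computed. A comparison up to a factor 2
  with the time integral of the squared norm of the functional is enough, and this integral is the
  same for every step because the operator is deterministic and the kernel depends only on the
  remaining time.\<close>

definition fourier_deriv :: "coeffs \<Rightarrow> coeffs" where
  "fourier_deriv a k = \<i> * of_int k * a k"

lemma fourier_series_summable:
  assumes "(\<lambda>k. norm (c k)) summable_on UNIV"
  shows "(\<lambda>k. c k * cis (real_of_int k * x)) summable_on UNIV"
  by (rule abs_summable_summable) (use assms in \<open>simp add: norm_mult\<close>)

lemma fourier_fun_has_sum:
  assumes "(\<lambda>k. norm (c k)) summable_on UNIV"
  shows "((\<lambda>k. Re (c k * cis (real_of_int k * x))) has_sum fourier_fun c x) UNIV"
  unfolding fourier_fun_def
  by (intro has_sum_Re has_sum_infsum fourier_series_summable assms)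

text \<open>Termwise differentiation is a theorem about series over \<open>nat\<close>, so the modes
  are enumerated by \<open>int_decode\<close>; absolute convergence makes the order
  irrelevant.\<close>

lemma fourier_fun_sums:
  assumes "(\<lambda>k. norm (c k)) summable_on UNIV"
  shows "(\<lambda>n. Re (c (int_decode n) * cis (real_of_int (int_decode n) * x))) sums fourier_fun c x"
proof -
  have "((\<lambda>n. Re (c (int_decode n) * cis (real_of_int (int_decode n) * x))) has_sum fourier_fun c x) UNIV"
    using fourier_fun_has_sum[OF assms, of x]
    by (subst has_sum_reindex_bij_betw[OF bij_int_decode])
  then show ?thesis by (rule has_sum_imp_sums)
qed

lemma summable_int_decode:
  assumes "(\<lambda>k. norm (c k)) summable_on (UNIV::int set)"
  shows "summable (\<lambda>n. norm (c (int_decode n)))"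
proof -
  have "(\<lambda>n. norm (c (int_decode n))) summable_on UNIV"
    using assms by (subst summable_on_reindex_bij_betw[OF bij_int_decode])
  then show ?thesis by (rule summable_on_imp_summable)
qed

lemma abs_Re_fourier_le: "\<bar>Re (c * cis y)\<bar> \<le> norm c"
  using abs_Re_le_cmod[of "c * cis y"] by (simp add: norm_mult)

lemma uniform_limit_fourier_series:
  assumes "(\<lambda>k. norm (c k)) summable_on UNIV"
  shows "uniform_limit A (\<lambda>F x. \<Sum>k\<in>F. c k * cis (real_of_int k * x))
           (\<lambda>x. \<Sum>\<^sub>\<infinity>k. c k * cis (real_of_int k * x)) (finite_subsets_at_top UNIV)"
  by (rule Weierstrass_m_test_general[OF _ assms]) (simp add: norm_mult)

lemma continuous_on_fourier_fun:
  assumes "(\<lambda>k. norm (c k)) summable_on UNIV"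
  shows "continuous_on A (fourier_fun c)"
proof -
  have "continuous_on A (\<lambda>x. \<Sum>\<^sub>\<infinity>k. c k * cis (real_of_int k * x))"
    by (rule uniform_limit_theorem[OF _ uniform_limit_fourier_series[OF assms]])
       (auto intro!: always_eventually continuous_intros)
  then show ?thesis
    unfolding fourier_fun_def[abs_def] by (intro continuous_intros)
qed

lemma fourier_fun_has_derivative:
  assumes a: "(\<lambda>k. norm (a k)) summable_on UNIV"
    and da: "(\<lambda>k. norm (fourier_deriv a k)) summable_on UNIV"
  shows "(fourier_fun a has_real_derivative fourier_fun (fourier_deriv a) x) (at x)"
proof -
  let ?f = "\<lambda>n x. Re (a (int_decode n) * cis (real_of_int (int_decode n) * x))"
  let ?f' = "\<lambda>n x. Re (fourier_deriv a (int_decode n) * cis (real_of_int (int_decode n) * x))"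
  have "((\<lambda>x. \<Sum>n. ?f n x) has_real_derivative (\<Sum>n. ?f' n x)) (at x)"
  proof (rule has_field_derivative_series'(2)[where S = UNIV and ?x0.0 = x])
    show "(?f n has_real_derivative ?f' n y) (at y within UNIV)" for n y
      by (auto intro!: derivative_eq_intros simp: fourier_deriv_def algebra_simps)
    show "uniformly_convergent_on UNIV (\<lambda>n x. \<Sum>i<n. ?f' i x)"
      unfolding uniformly_convergent_on_def
      by (intro exI[of _ "\<lambda>y. \<Sum>n. ?f' n y"] Weierstrass_m_test[OF _ summable_int_decode[OF da]])
         (simp only: real_norm_def abs_Re_fourier_le)
  qed (use fourier_fun_sums[OF a] in \<open>auto simp: sums_iff\<close>)
  moreover have "(\<lambda>x. \<Sum>n. ?f n x) = fourier_fun a" "(\<Sum>n. ?f' n x) = fourier_fun (fourier_deriv a) x"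
    using fourier_fun_sums[OF a] fourier_fun_sums[OF da] by (auto simp: sums_iff)
  ultimately show ?thesis by simp
qed

lemma fourier_fun_diff_le:
  assumes a: "(\<lambda>k. norm (a k)) summable_on UNIV" and b: "(\<lambda>k. norm (b k)) summable_on UNIV"
    and d: "(\<lambda>k. norm (a k - b k)) summable_on UNIV"
  shows "\<bar>fourier_fun a x - fourier_fun b x\<bar> \<le> (\<Sum>\<^sub>\<infinity>k. norm (a k - b k))"
proof -
  have "((\<lambda>k. Re (a k * cis (real_of_int k * x)) + - Re (b k * cis (real_of_int k * x)))
          has_sum fourier_fun a x + - fourier_fun b x) UNIV"
    using fourier_fun_has_sum[OF a] fourier_fun_has_sum[OF b]
    by (intro has_sum_add) (simp_all only: has_sum_uminus minus_minus)
  then have "((\<lambda>k. Re ((a k - b k) * cis (real_of_int k * x))) has_sum fourier_fun a x - fourier_fun b x) UNIV"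
    by (simp add: algebra_simps)
  from norm_infsum_le[OF this has_sum_infsum[OF d]] abs_Re_fourier_le show ?thesis
    by (simp only: real_norm_def)
qed

section \<open>Fourier coefficients as integrals over one period\<close>

lemma has_integral_cis_0_2pi:
  "((\<lambda>x. cis (real_of_int m * x)) has_integral (if m = 0 then of_real (2 * pi) else 0)) {0..2 * pi}"
proof (cases "m = 0")
  case True
  then show ?thesis
    using has_integral_const_real[of "1::complex" 0 "2 * pi"] by (simp add: scaleR_conv_of_real)
next
  case False
  let ?F = "\<lambda>x. cis (real_of_int m * x) / (\<i> * of_int m)"
  have "((\<lambda>x. cis (real_of_int m * x)) has_integral ?F (2 * pi) - ?F 0) {0..2 * pi}"
  proof (rule fundamental_theorem_of_calculus)
    fix x :: real
    have "((\<lambda>x. exp (\<i> * of_real (real_of_int m * x)) / (\<i> * of_int m)) has_vector_derivative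
             exp (\<i> * of_real (real_of_int m * x))) (at x within {0..2 * pi})"
      using False by (auto intro!: derivative_eq_intros has_vector_derivative_real_field simp: field_simps)
    then show "(?F has_vector_derivative cis (real_of_int m * x)) (at x within {0..2 * pi})"
      by (simp add: cis_conv_exp)
  qed simp
  moreover have "cis (real_of_int m * (2 * pi)) = 1"
    using cis_multiple_2pi[of "of_int m"] by (simp add: mult_ac)
  ultimately show ?thesis using False by simp
qed

lemma fourier_coeff_has_integral:
  fixes c :: coeffs
  assumes c: "(\<lambda>k. norm (c k)) summable_on UNIV"
  shows "((\<lambda>x. (\<Sum>\<^sub>\<infinity>j. c j * cis (real_of_int j * x)) * cis (- (real_of_int k * x)))
            has_integral of_real (2 * pi) * c k) {0..2 * pi}"
proof -
  let ?g = "\<lambda>F x. \<Sum>j\<in>F. c j * cis (real_of_int j * x) * cis (- (real_of_int k * x))"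
  have "uniform_limit {0..2 * pi} ?g
          (\<lambda>x. \<Sum>\<^sub>\<infinity>j. c j * cis (real_of_int j * x) * cis (- (real_of_int k * x)))
          (finite_subsets_at_top UNIV)"
    by (rule Weierstrass_m_test_general[OF _ c]) (simp add: norm_mult)
  then obtain I J where I: "\<And>F. (?g F has_integral I F) {0..2 * pi}"
    and J: "((\<lambda>x. \<Sum>\<^sub>\<infinity>j. c j * cis (real_of_int j * x) * cis (- (real_of_int k * x))) has_integral J) {0..2 * pi}"
    and lim: "(I \<longlongrightarrow> J) (finite_subsets_at_top UNIV)"
    by (rule uniform_limit_integral) (auto intro!: continuous_intros)
  \<comment> \<open>By orthogonality every finite set of modes that contains \<open>k\<close>
    already gives the final value, so the net of integrals is eventually constant.\<close>
  have "I F = of_real (2 * pi) * c k" if "finite F" "k \<in> F" for F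
  proof -
    have "(?g F has_integral (\<Sum>j\<in>F. c j * (if j - k = 0 then of_real (2 * pi) else 0))) {0..2 * pi}"
    proof (rule has_integral_sum[OF that(1)])
      fix j
      have "(\<lambda>x. c j * cis (real_of_int j * x) * cis (- (real_of_int k * x)))
              = (\<lambda>x. c j * cis (real_of_int (j - k) * x))"
        by (simp add: mult.assoc cis_mult algebra_simps)
      then show "((\<lambda>x. c j * cis (real_of_int j * x) * cis (- (real_of_int k * x))) has_integral
           c j * (if j - k = 0 then of_real (2 * pi) else 0)) {0..2 * pi}"
        using has_integral_mult_right[OF has_integral_cis_0_2pi, of "c j" "j - k"] by simp
    qed
    also have "(\<Sum>j\<in>F. c j * (if j - k = 0 then of_real (2 * pi) else 0)) = (\<Sum>j\<in>F. if j = k then of_real (2 * pi) * c k else 0)"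
      by (intro sum.cong) auto
    finally have "(?g F has_integral of_real (2 * pi) * c k) {0..2 * pi}" using that by simp
    then show ?thesis using I has_integral_unique by blast
  qed
  then have "eventually (\<lambda>F. I F = of_real (2 * pi) * c k) (finite_subsets_at_top UNIV)"
    unfolding eventually_finite_subsets_at_top by (intro exI[of _ "{k}"]) auto
  then have "J = of_real (2 * pi) * c k"
    using lim tendsto_unique tendsto_eventually finite_subsets_at_top_neq_bot by metis
  moreover have "(\<Sum>\<^sub>\<infinity>j. c j * cis (real_of_int j * x) * cis (- (real_of_int k * x)))
      = (\<Sum>\<^sub>\<infinity>j. c j * cis (real_of_int j * x)) * cis (- (real_of_int k * x))" for x
    by (rule infsum_cmult_left) (auto intro: fourier_series_summable c)
  ultimately show ?thesis using J by simp
qed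

text \<open>Replacing k by -k turns the conjugate series into the series itself, so its sum is real
  and the \<open>Re\<close> in \<open>fourier_fun\<close> loses nothing.\<close>

lemma of_real_fourier_fun:
  assumes c: "(\<lambda>k. norm (c k)) summable_on UNIV" and sym: "\<And>k. c (- k) = cnj (c k)"
  shows "of_real (fourier_fun c x) = (\<Sum>\<^sub>\<infinity>k. c k * cis (real_of_int k * x))"
proof -
  let ?S = "\<Sum>\<^sub>\<infinity>k. c k * cis (real_of_int k * x)"
  have "cnj ?S = (\<Sum>\<^sub>\<infinity>k. cnj (c k * cis (real_of_int k * x)))"
    by (rule infsum_cnj[symmetric])
  also have "\<dots> = (\<Sum>\<^sub>\<infinity>k. c (- k) * cis (real_of_int (- k) * x))"
    by (simp add: sym cis_cnj)
  also have "\<dots> = ?S"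
    by (rule infsum_reindex_bij_betw) (rule bij_uminus)
  finally have "cnj ?S = ?S" .
  then show ?thesis unfolding fourier_fun_def by (simp add: complex_eq_iff)
qed

text \<open>Monotonicity makes 1 + r a' nonnegative, so its L1 norm over a period is just its
  integral 2 pi, and the L1 norm bounds every Fourier integral. In a mode k other than 0 the
  constant 1 contributes nothing and 2 pi r i k a_k is left. The sign of \<open>r\<close> is free:
  \<open>r = h\<close> serves initial values, \<open>r = - h\<close> terminal ones.\<close>

lemma fourier_coeff_le_if_increasing:
  assumes a: "(\<lambda>k. norm (a k)) summable_on UNIV"
    and da: "(\<lambda>k. norm (fourier_deriv a k)) summable_on UNIV"
    and sym: "\<And>k. a (- k) = cnj (a k)"
    and incr: "mono (\<lambda>x. x + r * fourier_fun a x)"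
    and k: "k \<noteq> 0"
  shows "\<bar>r\<bar> * norm (of_int k * a k) \<le> 1"
proof -
  define D where "D = fourier_fun (fourier_deriv a)"
  have D: "of_real (D x) = (\<Sum>\<^sub>\<infinity>k. fourier_deriv a k * cis (real_of_int k * x))" for x
    unfolding D_def by (rule of_real_fourier_fun[OF da]) (simp add: fourier_deriv_def sym)
  have int: "((\<lambda>x. of_real (D x) * cis (- (real_of_int j * x))) has_integral of_real (2 * pi) * fourier_deriv a j) {0..2 * pi}" for j
    unfolding D by (rule fourier_coeff_has_integral[OF da])
  have nn: "1 + r * D x \<ge> 0" for x
  proof -
    have "((\<lambda>x. x + r * fourier_fun a x) has_real_derivative 1 + r * D x) (at x)"
      unfolding D_def by (auto intro!: derivative_eq_intros fourier_fun_has_derivative[OF a da])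
    then show ?thesis
      using incr by (intro mono_on_imp_deriv_nonneg[where A = UNIV and f = "\<lambda>x. x + r * fourier_fun a x"]) (auto simp: mono_def mono_on_def)
  qed
  have "((\<lambda>x. cis (real_of_int (- k) * x) + r * (of_real (D x) * cis (- (real_of_int k * x))))
     has_integral (if - k = 0 then of_real (2 * pi) else 0) + r * (of_real (2 * pi) * fourier_deriv a k)) {0..2 * pi}"
    by (intro has_integral_add has_integral_mult_right int has_integral_cis_0_2pi)
  then have 1: "((\<lambda>x. of_real (1 + r * D x) * cis (- (real_of_int k * x)))
      has_integral of_real (2 * pi * r) * fourier_deriv a k) {0..2 * pi}"
    using k by (simp add: algebra_simps)
  \<comment> \<open>A derivative has no zeroth mode, so the mean of \<open>1 + r * D x\<close> over
    a period is 1.\<close>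
  have "((\<lambda>x. complex_of_real (1 + r * D x)) has_integral of_real (2 * pi)) {0..2 * pi}"
    using has_integral_add[OF has_integral_cis_0_2pi[of 0] has_integral_mult_right[OF int[of 0], of r]]
    by (simp add: fourier_deriv_def)
  then have "((\<lambda>x. Re (complex_of_real (1 + r * D x))) has_integral Re (of_real (2 * pi))) {0..2 * pi}"
    by (rule has_integral_Re)
  then have 2: "((\<lambda>x. 1 + r * D x) has_integral 2 * pi) {0..2 * pi}"
    by simp
  have "norm (integral {0..2 * pi} (\<lambda>x. of_real (1 + r * D x) * cis (- (real_of_int k * x))))
          \<le> integral {0..2 * pi} (\<lambda>x. 1 + r * D x)"
  proof (rule integral_norm_bound_integral)
    show "norm (of_real (1 + r * D x) * cis (- (real_of_int k * x))) \<le> 1 + r * D x" for x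
      using nn[of x] by (simp only: norm_mult norm_of_real norm_cis mult_1_right abs_of_nonneg)
  qed (use 1 2 in \<open>blast intro: has_integral_integrable\<close>)+
  then have "norm (of_real (2 * pi * r) * fourier_deriv a k) \<le> 2 * pi"
    by (simp only: integral_unique[OF 1] integral_unique[OF 2])
  then show ?thesis
    by (simp add: fourier_deriv_def norm_mult abs_mult mult.assoc)
qed

section \<open>Sobolev embedding for orders above 3/2\<close>

lemma summable_on_int_powr:
  assumes "s < -1"
  shows "(\<lambda>k::int. (1 + (real_of_int k)\<^sup>2) powr (s / 2)) summable_on UNIV"
proof -
  let ?f = "\<lambda>k::int. (1 + (real_of_int k)\<^sup>2) powr (s / 2)"
  have "summable (\<lambda>n. (1 + (real n)\<^sup>2) powr (s / 2))"
  proof (rule summable_comparison_test_ev)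
    show "summable (\<lambda>n. real n powr s)"
      using assms by (simp add: summable_real_powr_iff)
    show "\<forall>\<^sub>F n in sequentially. norm ((1 + (real n)\<^sup>2) powr (s / 2)) \<le> real n powr s"
      using eventually_gt_at_top[of 0]
    proof eventually_elim
      case (elim n)
      have "(1 + (real n)\<^sup>2) powr (s / 2) \<le> ((real n)\<^sup>2) powr (s / 2)"
        using assms elim by (intro powr_mono2') auto
      also have "\<dots> = real n powr s"
      proof -
        have "(real n)\<^sup>2 = real n powr 2" using elim by simp
        then show ?thesis by (simp only: powr_powr) simp
      qed
      finally show ?case by simp
    qed
  qed
  then have 1: "(\<lambda>n. ?f (int n)) summable_on UNIV"
    by (subst summable_on_UNIV_nonneg_real_iff) auto
  then have "?f summable_on range int"
    by (subst summable_on_reindex) (auto simp: o_def)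
  moreover have "?f summable_on range (\<lambda>n. - int n)"
    using 1 by (subst summable_on_reindex) (auto simp: o_def inj_on_def)
  ultimately have "?f summable_on (range int \<union> range (\<lambda>n. - int n))"
    by (rule summable_on_union)
  moreover have "range int \<union> range (\<lambda>n. - int n) = UNIV"
  proof (intro UNIV_eq_I[symmetric])
    show "k \<in> range int \<union> range (\<lambda>n. - int n)" for k
      by (cases k rule: int_cases2) auto
  qed
  ultimately show ?thesis by simp
qed

text \<open>Cauchy-Schwarz against the weights \<open>g\<close>, whose squares decay like |k|^(2 - 2
  sigma) and are summable because sigma > 3/2. The factor 1 + |k| controls a Fourier series and its
  derived series at once.\<close>

lemma sobolev_embedding:
  assumes "\<sigma> > 3 / 2"
  obtains K where "\<And>a. a \<in> sobolev_space \<sigma> \<Longrightarrow> (\<lambda>k. (1 + \<bar>real_of_int k\<bar>) * norm (a k)) summable_on UNIV"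
    and "\<And>a. a \<in> sobolev_space \<sigma> \<Longrightarrow> (\<Sum>\<^sub>\<infinity>k. (1 + \<bar>real_of_int k\<bar>) * norm (a k)) \<le> K * sobolev_norm \<sigma> a"
proof -
  define g where "g k = (1 + \<bar>real_of_int k\<bar>) / sqrt (sobolev_weight \<sigma> k)" for k
  have g2: "(g k)\<^sup>2 \<le> 2 * (1 + (real_of_int k)\<^sup>2) powr ((2 - 2 * \<sigma>) / 2)" for k
  proof -
    have "(1 + \<bar>real_of_int k\<bar>)\<^sup>2 \<le> 2 * (1 + (real_of_int k)\<^sup>2)"
      using zero_le_power2[of "1 - \<bar>real_of_int k\<bar>"] by (simp add: power2_eq_square algebra_simps)
    then have "(g k)\<^sup>2 \<le> 2 * (1 + (real_of_int k)\<^sup>2) / sobolev_weight \<sigma> k"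
      using sobolev_weight_pos[of \<sigma> k] by (simp add: g_def power_divide divide_right_mono)
    also have "\<dots> = 2 * (1 + (real_of_int k)\<^sup>2) powr (1 - \<sigma>)"
      by (simp add: sobolev_weight_def powr_diff add_pos_nonneg)
    finally show ?thesis by (simp add: diff_divide_distrib)
  qed
  have sg: "(\<lambda>k. (g k)\<^sup>2) summable_on UNIV"
  proof (rule summable_on_comparison_test)
    show "(\<lambda>k::int. 2 * (1 + (real_of_int k)\<^sup>2) powr ((2 - 2 * \<sigma>) / 2)) summable_on UNIV"
      using assms by (intro summable_on_cmult_right summable_on_int_powr) auto
  qed (use g2 in auto)
  define K where "K = sqrt (\<Sum>\<^sub>\<infinity>k. (g k)\<^sup>2)"
  have fin: "(\<Sum>k\<in>F. (1 + \<bar>real_of_int k\<bar>) * norm (a k)) \<le> K * sobolev_norm \<sigma> a"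
    if a: "a \<in> sobolev_space \<sigma>" and F: "finite F" for a F
  proof -
    define f where "f k = sqrt (sobolev_weight \<sigma> k) * norm (a k)" for k
    have "(\<Sum>k\<in>F. (1 + \<bar>real_of_int k\<bar>) * norm (a k)) = (\<Sum>k\<in>F. \<bar>g k\<bar> * \<bar>f k\<bar>)"
      using sobolev_weight_pos[of \<sigma>] by (intro sum.cong) (auto simp: f_def g_def abs_mult less_imp_neq[THEN not_sym])
    also have "\<dots> \<le> L2_set g F * L2_set f F"
      by (rule L2_set_mult_ineq)
    also have "\<dots> \<le> K * sobolev_norm \<sigma> a"
    proof (intro mult_mono)
      show "L2_set g F \<le> K"
        unfolding L2_set_def K_def using sg F by (intro real_sqrt_le_mono finite_sum_le_infsum) auto
      show "L2_set f F \<le> sobolev_norm \<sigma> a"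
        using a F unfolding L2_set_def sobolev_norm_def f_def sobolev_space_def
        by (intro real_sqrt_le_mono) (auto simp: power_mult_distrib intro!: finite_sum_le_infsum)
    qed (auto simp: K_def infsum_nonneg L2_set_nonneg)
    finally show ?thesis .
  qed
  have sm: "(\<lambda>k. (1 + \<bar>real_of_int k\<bar>) * norm (a k)) summable_on UNIV" if "a \<in> sobolev_space \<sigma>" for a
    by (rule nonneg_bdd_above_summable_on) (auto intro!: bdd_aboveI fin[OF that])
  show thesis
    by (rule that[OF sm]) (auto intro!: infsum_le_finite_sums[OF sm] fin)
qed

lemma
  assumes "\<sigma> > 3 / 2" "a \<in> sobolev_space \<sigma>"
  shows sobolev_abs_summable: "(\<lambda>k. norm (a k)) summable_on UNIV"
    and sobolev_deriv_abs_summable: "(\<lambda>k. norm (fourier_deriv a k)) summable_on UNIV"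
proof -
  obtain K where "(\<lambda>k. (1 + \<bar>real_of_int k\<bar>) * norm (a k)) summable_on UNIV"
    using sobolev_embedding[OF assms(1)] assms(2) by metis
  then show "(\<lambda>k. norm (a k)) summable_on UNIV" "(\<lambda>k. norm (fourier_deriv a k)) summable_on UNIV"
    by (auto elim!: summable_on_comparison_test simp: fourier_deriv_def norm_mult distrib_right mult_right_mono)
qed

lemma sobolev_symmetric: "a \<in> sobolev_space \<sigma> \<Longrightarrow> a (- k) = cnj (a k)"
  by (simp add: sobolev_space_def)

lemma topspace_sobolev: "topspace (sobolev_topology s) = sobolev_space s"
  by (simp add: sobolev_topology_def Metric_space.topspace_mtopology[OF Metric_space_sobolev])

lemma sobolev_fourier_fun_bounds:
  assumes "\<sigma> > 3 / 2"
  obtains K where "K \<ge> 0"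
    and "\<And>a b x. a \<in> sobolev_space \<sigma> \<Longrightarrow> b \<in> sobolev_space \<sigma> \<Longrightarrow>
          \<bar>fourier_fun a x - fourier_fun b x\<bar> \<le> K * sobolev_dist \<sigma> a b"
    and "\<And>a b x. a \<in> sobolev_space \<sigma> \<Longrightarrow> b \<in> sobolev_space \<sigma> \<Longrightarrow>
          \<bar>fourier_fun (fourier_deriv a) x - fourier_fun (fourier_deriv b) x\<bar> \<le> K * sobolev_dist \<sigma> a b"
proof -
  obtain K where K1: "\<And>a. a \<in> sobolev_space \<sigma> \<Longrightarrow> (\<lambda>k. (1 + \<bar>real_of_int k\<bar>) * norm (a k)) summable_on UNIV"
    and K2: "\<And>a. a \<in> sobolev_space \<sigma> \<Longrightarrow> (\<Sum>\<^sub>\<infinity>k. (1 + \<bar>real_of_int k\<bar>) * norm (a k)) \<le> K * sobolev_norm \<sigma> a"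
    by (rule sobolev_embedding[OF assms]) iprover
  have K: "K * sobolev_norm \<sigma> c \<le> \<bar>K\<bar> * sobolev_norm \<sigma> c" for c
    by (intro mult_right_mono) auto
  note sm = sobolev_abs_summable[OF assms] sobolev_deriv_abs_summable[OF assms]
  have dd: "fourier_deriv a k - fourier_deriv b k = fourier_deriv (\<lambda>k. a k - b k) k" for a b k
    by (simp add: fourier_deriv_def right_diff_distrib)
  show thesis
  proof (rule that[of "\<bar>K\<bar>"])
    fix a b x assume ab: "a \<in> sobolev_space \<sigma>" "b \<in> sobolev_space \<sigma>"
    note d = sobolev_space_diff[OF ab]
    have "(\<Sum>\<^sub>\<infinity>k. norm (a k - b k)) \<le> (\<Sum>\<^sub>\<infinity>k. (1 + \<bar>real_of_int k\<bar>) * norm (a k - b k))"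
      by (intro infsum_mono sm(1)[OF d] K1[OF d]) (simp add: distrib_right)
    also have "\<dots> \<le> \<bar>K\<bar> * sobolev_dist \<sigma> a b"
      using K2[OF d] K unfolding sobolev_dist_def by (rule order_trans)
    finally show "\<bar>fourier_fun a x - fourier_fun b x\<bar> \<le> \<bar>K\<bar> * sobolev_dist \<sigma> a b"
      using fourier_fun_diff_le[OF sm(1)[OF ab(1)] sm(1)[OF ab(2)] sm(1)[OF d], of x] by linarith
    have "(\<Sum>\<^sub>\<infinity>k. norm (fourier_deriv a k - fourier_deriv b k)) \<le> (\<Sum>\<^sub>\<infinity>k. (1 + \<bar>real_of_int k\<bar>) * norm (a k - b k))"
      unfolding dd
      by (intro infsum_mono sm(2)[OF d] K1[OF d]) (simp add: distrib_right fourier_deriv_def norm_mult)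
    also have "\<dots> \<le> \<bar>K\<bar> * sobolev_dist \<sigma> a b"
      using K2[OF d] K unfolding sobolev_dist_def by (rule order_trans)
    finally show "\<bar>fourier_fun (fourier_deriv a) x - fourier_fun (fourier_deriv b) x\<bar> \<le> \<bar>K\<bar> * sobolev_dist \<sigma> a b"
      using fourier_fun_diff_le[of "fourier_deriv a" "fourier_deriv b" x] sm(2)[OF ab(1)] sm(2)[OF ab(2)] sm(2)[OF d]
      by (simp add: dd)
  qed auto
qed

text \<open>The increment splits into a change of the state at fixed x, bounded uniformly in x, and
  a change of x at the fixed state \<open>v t0\<close>. It is applied to the space derivative of a
  Burgers solution, whose joint continuity gives total differentiability.\<close>

lemma continuous_jointly_if_lipschitz:
  assumes L: "\<And>a b x. a \<in> S \<Longrightarrow> b \<in> S \<Longrightarrow> \<bar>\<Phi> a x - \<Phi> b x\<bar> \<le> K * d a b"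
    and cont: "\<And>a. a \<in> S \<Longrightarrow> continuous_on UNIV (\<Phi> a)"
    and v: "\<And>t. t \<in> T \<Longrightarrow> v t \<in> S" and t0: "t0 \<in> T"
    and lim: "((\<lambda>t. d (v t) (v t0)) \<longlongrightarrow> 0) (at t0 within T)"
    and d0: "d (v t0) (v t0) = 0"
  shows "continuous (at (t0, x0::real) within T \<times> UNIV) (\<lambda>(t::real, x). \<Phi> (v t) x :: real)"
proof -
  have c: "continuous (at t0 within T) (\<lambda>t. d (v t) (v t0))"
    using lim d0 by (simp add: continuous_within)
  have fst: "continuous (at (t0, x0) within T \<times> UNIV) (\<lambda>p. d (v (fst p)) (v t0))"
    using c by (intro continuous_within_compose2[where f = fst and g = "\<lambda>t. d (v t) (v t0)" and s = "T \<times> UNIV"])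
      (auto intro!: continuous_intros continuous_within_subset[OF c])
  have 1: "((\<lambda>p. K * d (v (fst p)) (v t0) + \<bar>\<Phi> (v t0) (snd p) - \<Phi> (v t0) x0\<bar>) \<longlongrightarrow> K * 0 + \<bar>\<Phi> (v t0) x0 - \<Phi> (v t0) x0\<bar>)
           (at (t0, x0) within T \<times> UNIV)"
  proof (intro tendsto_intros)
    show "((\<lambda>p. d (v (fst p)) (v t0)) \<longlongrightarrow> 0) (at (t0, x0) within T \<times> UNIV)"
      using fst d0 by (simp add: continuous_within)
    have "isCont (\<Phi> (v t0)) x0"
      using cont[OF v[OF t0]] by (simp add: continuous_on_eq_continuous_at)
    then show "((\<lambda>p. \<Phi> (v t0) (snd p)) \<longlongrightarrow> \<Phi> (v t0) x0) (at (t0, x0) within T \<times> UNIV)"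
      by (rule isCont_tendsto_compose) (auto intro!: tendsto_eq_intros)
  qed
  have "((\<lambda>p. \<Phi> (v (fst p)) (snd p) - \<Phi> (v t0) x0) \<longlongrightarrow> 0) (at (t0, x0) within T \<times> UNIV)"
  proof (rule Lim_null_comparison)
    show "\<forall>\<^sub>F p in at (t0, x0) within T \<times> UNIV. norm (\<Phi> (v (fst p)) (snd p) - \<Phi> (v t0) x0)
        \<le> K * d (v (fst p)) (v t0) + \<bar>\<Phi> (v t0) (snd p) - \<Phi> (v t0) x0\<bar>"
      unfolding eventually_at_filter
    proof (intro always_eventually allI impI)
      fix p :: "real \<times> real" assume "p \<in> T \<times> UNIV"
      then show "norm (\<Phi> (v (fst p)) (snd p) - \<Phi> (v t0) x0)
        \<le> K * d (v (fst p)) (v t0) + \<bar>\<Phi> (v t0) (snd p) - \<Phi> (v t0) x0\<bar>"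
        using L[OF v[of "fst p"] v[OF t0], of "snd p"] by auto
    qed
  qed (use 1 in simp)
  then show ?thesis
    by (simp add: continuous_within case_prod_unfold Lim_null[symmetric])
qed

section \<open>Classical solutions of the Burgers equation\<close>

context
  fixes \<sigma> h :: real and f :: coeffs and v :: "real \<Rightarrow> coeffs"
  assumes \<sigma>: "\<sigma> > 3 / 2" and h: "h > 0" and sol: "burgers_solution \<sigma> h f v"
begin

lemma burgers_solution_space: "t \<in> {0..h} \<Longrightarrow> v t \<in> sobolev_space \<sigma>"
  using sol continuous_map_image_subset_topspace
  by (fastforce simp: burgers_solution_def topspace_sobolev)

lemma burgers_solution_init: "f = v 0" "f \<in> sobolev_space \<sigma>"
  using sol burgers_solution_space[of 0] h by (auto simp: burgers_solution_def)

lemma burgers_solution_dist_tendsto: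
  assumes t0: "t0 \<in> {0..h}"
  shows "((\<lambda>t. sobolev_dist \<sigma> (v t) (v t0)) \<longlongrightarrow> 0) (at t0 within {0..h})"
proof (rule tendstoI)
  interpret Metric_space "sobolev_space \<sigma>" "sobolev_dist \<sigma>"
    by (rule Metric_space_sobolev)
  fix e :: real assume "e > 0"
  moreover have "continuous_map (top_of_set {0..h}) mtopology v"
    using sol by (simp add: burgers_solution_def sobolev_topology_def)
  ultimately obtain U where U: "openin (top_of_set {0..h}) U" "t0 \<in> U" "\<forall>t\<in>U. v t \<in> mball (v t0) e"
    using t0 unfolding continuous_map_to_metric topspace_euclidean_subtopology by metis
  then obtain T where "open T" "U = {0..h} \<inter> T" by (auto simp: openin_open)
  with U show "\<forall>\<^sub>F t in at t0 within {0..h}. dist (sobolev_dist \<sigma> (v t) (v t0)) 0 < e"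
    unfolding eventually_at_topological
    by (intro exI[of _ T]) (auto simp: mball_def commute[of "v t0"])
qed

lemma burgers_has_derivative_x:
  "t \<in> {0..h} \<Longrightarrow> (fourier_fun (v t) has_real_derivative fourier_fun (fourier_deriv (v t)) x) (at x)"
  by (intro fourier_fun_has_derivative sobolev_abs_summable[OF \<sigma>] sobolev_deriv_abs_summable[OF \<sigma>] burgers_solution_space)

lemma burgers_has_derivative_t:
  assumes t: "t \<in> {0..h}"
  shows "((\<lambda>r. fourier_fun (v r) x) has_real_derivative
            - fourier_fun (v t) x * fourier_fun (fourier_deriv (v t)) x) (at t within {0..h})"
proof -
  obtain vt vx where vt: "((\<lambda>r. fourier_fun (v r) x) has_real_derivative vt) (at t within {0..h})"
    and vx: "(fourier_fun (v t) has_real_derivative vx) (at x)" and eq: "vt + fourier_fun (v t) x * vx = 0"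
    using sol t unfolding burgers_solution_def by blast
  have "vx = fourier_fun (fourier_deriv (v t)) x"
    using vx burgers_has_derivative_x[OF t] by (rule DERIV_unique)
  with eq have "vt = - fourier_fun (v t) x * fourier_fun (fourier_deriv (v t)) x" by simp
  with vt show ?thesis by simp
qed

lemma burgers_deriv_x_continuous:
  assumes t: "t \<in> {0..h}"
  shows "continuous (at (t, x) within {0..h} \<times> UNIV) (\<lambda>(t, x). fourier_fun (fourier_deriv (v t)) x)"
proof -
  obtain K where K: "\<And>a b x. a \<in> sobolev_space \<sigma> \<Longrightarrow> b \<in> sobolev_space \<sigma> \<Longrightarrow>
          \<bar>fourier_fun (fourier_deriv a) x - fourier_fun (fourier_deriv b) x\<bar> \<le> K * sobolev_dist \<sigma> a b"
    by (rule sobolev_fourier_fun_bounds[OF \<sigma>]) iprover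
  show ?thesis
  proof (rule continuous_jointly_if_lipschitz[where S = "sobolev_space \<sigma>" and d = "sobolev_dist \<sigma>" and K = K
        and \<Phi> = "\<lambda>a. fourier_fun (fourier_deriv a)" and v = v, OF K])
    show "sobolev_dist \<sigma> (v t) (v t) = 0"
      by (simp add: sobolev_dist_def sobolev_norm_def)
  qed (use t burgers_solution_dist_tendsto burgers_solution_space in
      \<open>auto intro!: continuous_on_fourier_fun sobolev_deriv_abs_summable[OF \<sigma>]\<close>)
qed

text \<open>A Burgers solution comes with partial derivatives only. Joint continuity of the space
  derivative makes it differentiable in (t, x) relative to the strip, one-sidedly at its ends, and
  the chain rule along a line of slope c yields v_t + c v_x, where v_t = - v v_x.\<close>

lemma burgers_total_derivative:
  assumes t: "t \<in> {0..h}"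
  shows "((\<lambda>t. fourier_fun (v t) (y + t * c)) has_real_derivative
           (c - fourier_fun (v t) (y + t * c)) * fourier_fun (fourier_deriv (v t)) (y + t * c)) (at t within {0..h})"
proof -
  let ?x = "y + t * c"
  let ?D = "\<lambda>t x. fourier_fun (fourier_deriv (v t)) x"
  have 1: "((\<lambda>(t, x). fourier_fun (v t) x) has_derivative
      (\<lambda>(dt, dx). (- fourier_fun (v t) ?x * ?D t ?x) * dt + blinfun_apply (blinfun_mult_right (?D t ?x)) dx))
      (at (t, ?x) within {0..h} \<times> UNIV)"
  proof (rule has_derivative_partialsI)
    show "((\<lambda>t. fourier_fun (v t) ?x) has_derivative (*) (- fourier_fun (v t) ?x * ?D t ?x)) (at t within {0..h})"
      using burgers_has_derivative_t[OF t] by (simp add: has_field_derivative_def)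
    show "(fourier_fun (v s) has_derivative blinfun_apply (blinfun_mult_right (?D s x))) (at x within UNIV)"
      if "s \<in> {0..h}" for s x
      using burgers_has_derivative_x[OF that] by (simp add: has_field_derivative_def)
    have "continuous (at (t, ?x) within {0..h} \<times> UNIV) (\<lambda>p. blinfun_mult_right ((\<lambda>(t, x). ?D t x) p))"
      using burgers_deriv_x_continuous[OF t]
      by (intro bounded_linear.continuous[OF bounded_linear_blinfun_mult_right])
    then show "continuous (at (t, ?x) within {0..h} \<times> UNIV) (\<lambda>(t, x). blinfun_mult_right (?D t x))"
      by (simp add: case_prod_unfold)
  qed auto
  have 2: "((\<lambda>t. (t, y + t * c)) has_derivative (\<lambda>dt. (dt, dt * c))) (at t within {0..h})"
    by (auto intro!: derivative_eq_intros)
  have "((\<lambda>t. (\<lambda>(t, x). fourier_fun (v t) x) (t, y + t * c)) has_derivative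
      (\<lambda>dt. (\<lambda>(dt, dx). (- fourier_fun (v t) ?x * ?D t ?x) * dt + blinfun_apply (blinfun_mult_right (?D t ?x)) dx) (dt, dt * c)))
      (at t within {0..h})"
    by (rule has_derivative_in_compose[OF 2 has_derivative_subset[OF 1]]) auto
  then show ?thesis
    by (auto simp: has_field_derivative_def algebra_simps elim!: has_derivative_eq_rhs)
qed

text \<open>Freezing the slope at its initial value \<open>c\<close> avoids solving the
  characteristic equation: the defect \<open>w\<close> along the straight line obeys the linear
  equation w' = - w d with w(0) = 0, and a Gronwall argument forces it to vanish.\<close>

lemma burgers_characteristics:
  assumes t: "t \<in> {0..h}"
  shows "fourier_fun (v t) (y + t * fourier_fun f y) = fourier_fun f y"
proof -
  define c where "c = fourier_fun f y"
  define d where "d t = fourier_fun (fourier_deriv (v t)) (y + t * c)" for t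
  define w where "w t = fourier_fun (v t) (y + t * c) - c" for t
  have dw: "(w has_real_derivative - w t * d t) (at t within {0..h})" if "t \<in> {0..h}" for t
    unfolding w_def[abs_def] d_def using burgers_total_derivative[OF that]
    by (auto intro!: derivative_eq_intros)
  have "continuous_on {0..h} d"
    unfolding continuous_on_eq_continuous_within
  proof
    fix t assume t: "t \<in> {0..h}"
    have "continuous (at t within {0..h}) (\<lambda>t. (\<lambda>(t, x). fourier_fun (fourier_deriv (v t)) x) (t, y + t * c))"
      by (rule continuous_within_compose2[where f = "\<lambda>t. (t, y + t * c)"])
         (auto intro!: continuous_intros continuous_within_subset[OF burgers_deriv_x_continuous[OF t]])
    then show "continuous (at t within {0..h}) d" by (simp add: d_def[abs_def])
  qed
  then have "bounded (d ` {0..h})"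
    by (intro compact_imp_bounded compact_continuous_image) auto
  then obtain L where L: "\<And>t. t \<in> {0..h} \<Longrightarrow> \<bar>d t\<bar> \<le> L"
    unfolding bounded_iff by (metis imageI real_norm_def)
  \<comment> \<open>Since |d| is at most \<open>L\<close>, this exponential weight makes
    \<open>E\<close> decreasing; it starts at 0 and is nonnegative.\<close>
  define E where "E t = (w t)\<^sup>2 * exp (- 2 * L * t)" for t
  have dE: "(E has_real_derivative (- 2 * (d t + L)) * E t) (at t within {0..h})" if "t \<in> {0..h}" for t
    unfolding E_def[abs_def] using dw[OF that]
    by (auto intro!: derivative_eq_intros simp: power2_eq_square algebra_simps)
  have "E 0 \<ge> E t"
  proof (rule DERIV_nonpos_imp_decreasing_open[where f = E and a = 0 and b = t])
    fix s assume s: "0 < s" "s < t"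
    then have "s \<in> {0..h}" "at s within {0..h} = at s"
      using t by (auto intro!: at_within_interior)
    then have "(E has_real_derivative (- 2 * (d s + L)) * E s) (at s)"
      using dE by metis
    moreover have "(- 2 * (d s + L)) * E s \<le> 0"
      using L[OF \<open>s \<in> {0..h}\<close>] by (intro mult_nonpos_nonneg) (auto simp: E_def)
    ultimately show "\<exists>z. (E has_real_derivative z) (at s) \<and> z \<le> 0" by blast
  next
    have "continuous_on {0..h} E"
      using dE by (rule DERIV_continuous_on)
    then show "continuous_on {0..t} E" by (rule continuous_on_subset) (use t in auto)
  qed (use t in auto)
  moreover have "E 0 = 0"
    using burgers_solution_init by (simp add: E_def w_def c_def)
  moreover have "E t \<ge> 0" by (simp add: E_def)
  ultimately have "w t = 0" by (simp add: E_def mult_le_0_iff not_le[symmetric])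
  then show ?thesis by (simp add: w_def c_def)
qed

lemma burgers_characteristics_strict_mono: "strict_mono (\<lambda>y. y + h * fourier_fun f y)"
proof (rule strict_monoI, rule ccontr)
  let ?F = "fourier_fun f"
  fix y z :: real assume yz: "y < z" and "\<not> y + h * ?F y < z + h * ?F z"
  then have le: "z - y \<le> h * (?F y - ?F z)" by (simp add: algebra_simps)
  then have pos: "?F y - ?F z > 0" using yz h by (smt (verit) mult_nonneg_nonpos)
  \<comment> \<open>The time at which the characteristics from \<open>y\<close> and \<open>z\<close>
    meet; \<open>le\<close> says that it does not exceed \<open>h\<close>.\<close>
  define t where "t = (z - y) / (?F y - ?F z)"
  have "t \<in> {0..h}" using le pos yz by (simp add: t_def pos_divide_le_eq)
  moreover have "y + t * ?F y = z + t * ?F z"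
    using pos by (simp add: t_def field_simps)
  ultimately have "?F y = ?F z" using burgers_characteristics by metis
  with pos show False by simp
qed

text \<open>The map differs from the identity by at most \<open>h * B\<close>, where
  \<open>B\<close> is the absolute sum of the coefficients, so the intermediate value theorem
  applies on [x - h B, x + h B]. Surjectivity lets every point at time \<open>h\<close> be traced
  back to a foot.\<close>

lemma burgers_characteristics_surj: "surj (\<lambda>y. y + h * fourier_fun f y)"
proof -
  let ?G = "\<lambda>y. y + h * fourier_fun f y"
  note sm = sobolev_abs_summable[OF \<sigma> burgers_solution_init(2)]
  define B where "B = (\<Sum>\<^sub>\<infinity>k. norm (f k))"
  have B: "\<bar>fourier_fun f y\<bar> \<le> B" for y
    using fourier_fun_diff_le[of f "\<lambda>_. 0" y] sm by (simp add: B_def fourier_fun_def)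
  have cont: "continuous_on A ?G" for A
    by (intro continuous_intros continuous_on_fourier_fun sm)
  have "\<exists>y. x = ?G y" for x
  proof -
    have hB: "\<bar>h * fourier_fun f y\<bar> \<le> h * B" for y
      using B[of y] h by (simp add: abs_mult)
    have "B \<ge> 0" using B[of 0] by linarith
    have "\<exists>y\<ge>x - h * B. y \<le> x + h * B \<and> ?G y = x"
    proof (rule IVT')
      show "?G (x - h * B) \<le> x" "x \<le> ?G (x + h * B)"
        using hB[of "x - h * B"] hB[of "x + h * B"] by auto
    qed (use \<open>B \<ge> 0\<close> h cont in auto)
    then show ?thesis by blast
  qed
  then show ?thesis unfolding surj_def by blast
qed

text \<open>The value x - h v(h, x) is the foot y of the characteristic through (h, x), and the
  inverse of the increasing map from y to y + h f(y) is increasing.\<close>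

lemma burgers_terminal_incr: "mono (\<lambda>x. x + (- h) * fourier_fun (v h) x)"
proof (rule monoI)
  fix x x' :: real assume le: "x \<le> x'"
  obtain y y' where y: "x = y + h * fourier_fun f y" "x' = y' + h * fourier_fun f y'"
    using surjD[OF burgers_characteristics_surj, of x] surjD[OF burgers_characteristics_surj, of x'] by blast
  have "y \<le> y'"
    using le strict_mono_less_eq[OF burgers_characteristics_strict_mono, of y y'] by (simp only: y)
  moreover have "fourier_fun (v h) x = fourier_fun f y" "fourier_fun (v h) x' = fourier_fun f y'"
    using burgers_characteristics[of h] h unfolding y by auto
  ultimately show "x + (- h) * fourier_fun (v h) x \<le> x' + (- h) * fourier_fun (v h) x'"
    by (simp only:) (simp add: y(1) y(2) del: atLeastAtMost_iff)
qed

end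

text \<open>The characteristics issuing from \<open>f\<close> cover the whole line at time
  \<open>h\<close>, so \<open>f\<close> determines the terminal function, whose Fourier integrals
  recover the coefficients. Hence the \<open>THE\<close> in \<open>burgers_step\<close> denotes the
  terminal state of any solution.\<close>

lemma burgers_terminal_unique:
  assumes \<sigma>: "\<sigma> > 3 / 2" and h: "h > 0"
    and v: "burgers_solution \<sigma> h f v" and w: "burgers_solution \<sigma> h f w"
  shows "v h = w h"
proof
  fix k
  have hh: "h \<in> {0..h}" using h by simp
  have eq: "fourier_fun (v h) x = fourier_fun (w h) x" for x
  proof -
    obtain y where "x = y + h * fourier_fun f y"
      using surjD[OF burgers_characteristics_surj[OF \<sigma> h v], of x] by blast
    then show ?thesis
      using burgers_characteristics[OF \<sigma> h v hh] burgers_characteristics[OF \<sigma> h w hh] by simp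
  qed
  have I: "((\<lambda>x. of_real (fourier_fun (u h) x) * cis (- (real_of_int k * x))) has_integral of_real (2 * pi) * u h k) {0..2 * pi}"
    if "burgers_solution \<sigma> h f u" for u
    using fourier_coeff_has_integral[OF sobolev_abs_summable[OF \<sigma> burgers_solution_space[OF \<sigma> h that hh]], of k]
      of_real_fourier_fun[OF sobolev_abs_summable[OF \<sigma> burgers_solution_space[OF \<sigma> h that hh]]
        sobolev_symmetric[OF burgers_solution_space[OF \<sigma> h that hh]]]
    by simp
  show "v h k = w h k"
    using has_integral_unique[OF I[OF v] I[OF w, folded eq]] by simp
qed

lemma burgers_coeff_bounds:
  assumes \<sigma>: "\<sigma> > 3 / 2" and h: "h > 0" and v: "burgers_solution \<sigma> h f v" and k: "k \<noteq> 0"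
  shows "norm (f k) \<le> 1 / h" "norm (v h k) \<le> 1 / h"
proof -
  have hh: "h \<in> {0..h}" using h by simp
  have *: "norm (a k) \<le> 1 / h"
    if a: "a \<in> sobolev_space \<sigma>" and m: "mono (\<lambda>x. x + r * fourier_fun a x)" and r: "\<bar>r\<bar> = h" for a r
  proof -
    have "h * (\<bar>real_of_int k\<bar> * norm (a k)) \<le> 1"
      using fourier_coeff_le_if_increasing[OF sobolev_abs_summable[OF \<sigma> a] sobolev_deriv_abs_summable[OF \<sigma> a]
          sobolev_symmetric[OF a] m k] r by (simp add: norm_mult)
    \<comment> \<open>The gain |k| is given up: one bound for all nonzero modes is enough.\<close>
    moreover have "norm (a k) \<le> \<bar>real_of_int k\<bar> * norm (a k)"
      using k by (intro mult_le_cancel_right1[THEN iffD2]) auto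
    ultimately have "h * norm (a k) \<le> 1"
      using h by (smt (verit) mult_left_mono)
    then show ?thesis using h by (simp add: field_simps)
  qed
  show "norm (f k) \<le> 1 / h"
    using burgers_characteristics_strict_mono[OF \<sigma> h v] h
    by (intro *[of f h] burgers_solution_init(2)[OF \<sigma> h v] strict_mono_mono) auto
  show "norm (v h k) \<le> 1 / h"
    using burgers_terminal_incr[OF \<sigma> h v] h
    by (intro *[of "v h" "- h"] burgers_solution_space[OF \<sigma> h v hh]) auto
qed

lemma burgers_step_SomeD:
  assumes "\<sigma> > 3 / 2" "h > 0" "burgers_step \<sigma> h f = Some g"
  obtains v where "burgers_solution \<sigma> h f v" "v h = g"
proof -
  have "\<exists>v. burgers_solution \<sigma> h f v" and g: "g = (THE g. \<exists>v. burgers_solution \<sigma> h f v \<and> v h = g)"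
    using assms(3) by (auto simp: burgers_step_def split: if_splits)
  then obtain v where v: "burgers_solution \<sigma> h f v" by blast
  have "g = v h"
    unfolding g using v burgers_terminal_unique[OF assms(1,2)] by (intro the_equality) blast+
  with v that show thesis by blast
qed

text \<open>The number (i k)^3 is purely imaginary, so the Airy part is a rotation and the modulus
  of the multiplier is exp(- t lam).\<close>

lemma airy_semigroup_norm_le:
  assumes "lam \<ge> 0" "t \<ge> 0"
  shows "norm (airy_semigroup lam t a k) \<le> norm (a k)"
proof -
  have "norm (airy_semigroup lam t a k) = exp (- (t * lam)) * norm (a k)"
    by (simp add: airy_semigroup_def norm_mult power_mult_distrib power3_eq_cube)
  also have "\<dots> \<le> 1 * norm (a k)"
    using assms by (intro mult_right_mono) auto
  finally show ?thesis by simp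
qed

text \<open>One share 1/h bounds the state before the increment, as the output of a Burgers step
  that the Airy flow does not enlarge; the other bounds state plus increment, as the input of the
  next Burgers step. The index \<open>Suc N\<close> leaves out the first increment, which is added
  to the initial state, for which no bound is known.\<close>

lemma noise_coeff_le_if_no_breakdown:
  assumes \<sigma>: "\<sigma> > 3 / 2" and h: "h > 0" and lam: "lam \<ge> 0" and k: "k \<noteq> 0"
    and surv: "\<And>N. \<not> breaks_down_at \<sigma> h lam z V N"
  shows "norm (z (Suc N) k) \<le> 2 / h"
proof -
  have some: "\<exists>V'. lie_trotter \<sigma> h lam z V N = Some V'" for N
  proof (induction N)
    case (Suc N)
    then show ?case
      using surv[of N] by (auto simp: breaks_down_at_def burgers_step_def)
  qed auto
  obtain U where U: "lie_trotter \<sigma> h lam z V N = Some U" using some by blast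
  obtain U' where U': "lie_trotter \<sigma> h lam z V (Suc N) = Some U'" using some by blast
  have "burgers_step \<sigma> h (airy_step lam h (z N) U) = Some U'" using U U' by simp
  then have 1: "norm (U' k) \<le> 1 / h"
    using burgers_coeff_bounds[OF \<sigma> h _ k] by (metis burgers_step_SomeD[OF \<sigma> h])
  obtain v where "burgers_solution \<sigma> h (airy_step lam h (z (Suc N)) U') v"
    using surv[of "Suc N"] U' unfolding breaks_down_at_def by blast
  then have 2: "norm (airy_semigroup lam h U' k + z (Suc N) k) \<le> 1 / h"
    using burgers_coeff_bounds(1)[OF \<sigma> h _ k] by (fastforce simp: airy_step_def)
  have "norm (z (Suc N) k) \<le> norm (airy_semigroup lam h U' k + z (Suc N) k) + norm (airy_semigroup lam h U' k)"
    using norm_triangle_ineq4[of "airy_semigroup lam h U' k + z (Suc N) k" "airy_semigroup lam h U' k"] by simp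
  with 1 2 airy_semigroup_norm_le[OF lam, of h U' k] h show ?thesis by simp
qed

lemma lie_trotter_None_after_breakdown:
  assumes "breaks_down_at \<sigma> h lam z V N" "n > N"
  shows "lie_trotter \<sigma> h lam z V n = None"
proof -
  have "lie_trotter \<sigma> h lam z V (Suc N + m) = None" for m
    using assms(1) by (induction m) (auto simp: breaks_down_at_def burgers_step_def)
  moreover have "n = Suc N + (n - Suc N)" using assms(2) by simp
  ultimately show ?thesis by metis
qed

section \<open>Linear functionals on the noise space\<close>

text \<open>The squared operator norm. As a supremum in \<open>ennreal\<close> it exists without a
  boundedness proof or a representing vector, and \<open>v = 0\<close> contributes 0 because
  division by zero gives 0.\<close>

definition functional_norm_sq :: "('u::real_inner \<Rightarrow> real) \<Rightarrow> ennreal" where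
  "functional_norm_sq \<phi> = (SUP v. ennreal ((\<phi> v)\<^sup>2 / (norm v)\<^sup>2))"

lemma functional_norm_sq_le_if_dense:
  assumes \<phi>: "bounded_linear \<phi>" and D: "closure D = UNIV" and K: "K \<ge> 0"
    and le: "\<And>v. v \<in> D \<Longrightarrow> (\<phi> v)\<^sup>2 \<le> K * (norm v)\<^sup>2"
  shows "functional_norm_sq \<phi> \<le> ennreal K"
proof -
  have "closed {v. (\<phi> v)\<^sup>2 \<le> K * (norm v)\<^sup>2}"
    by (intro closed_Collect_le continuous_intros bounded_linear.continuous_on[OF \<phi>])
  then have "closure D \<subseteq> {v. (\<phi> v)\<^sup>2 \<le> K * (norm v)\<^sup>2}"
    by (intro closure_minimal) (auto intro: le)
  then have "(\<phi> v)\<^sup>2 \<le> K * (norm v)\<^sup>2" for v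
    using D by auto
  then show ?thesis
    unfolding functional_norm_sq_def using K
    by (intro SUP_least ennreal_leI) (simp add: divide_le_eq)
qed

text \<open>For countable \<open>D\<close> the norm becomes a countable supremum, hence a measurable
  function of a parameter such as time.\<close>

lemma functional_norm_sq_eq_SUP_dense:
  assumes \<phi>: "bounded_linear \<phi>" and D: "closure D = UNIV"
  shows "functional_norm_sq \<phi> = (SUP v\<in>D. ennreal ((\<phi> v)\<^sup>2 / (norm v)\<^sup>2))"
proof (rule antisym)
  let ?S = "SUP v\<in>D. ennreal ((\<phi> v)\<^sup>2 / (norm v)\<^sup>2)"
  show "functional_norm_sq \<phi> \<le> ?S"
  proof (cases ?S)
    case (real K)
    have "(\<phi> v)\<^sup>2 \<le> K * (norm v)\<^sup>2" if "v \<in> D" for v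
    proof (cases "v = 0")
      case True
      then show ?thesis using linear_simps(3)[OF \<phi>] by simp
    next
      case False
      have "ennreal ((\<phi> v)\<^sup>2 / (norm v)\<^sup>2) \<le> ennreal K"
        unfolding real(2)[symmetric] by (rule SUP_upper[OF that])
      then have "(\<phi> v)\<^sup>2 / (norm v)\<^sup>2 \<le> K" using real(1) by simp
      then show ?thesis using False by (simp add: divide_le_eq)
    qed
    then show ?thesis
      unfolding real(2) by (intro functional_norm_sq_le_if_dense[OF \<phi> D real(1)])
  qed (simp only: top_greatest)
  show "?S \<le> functional_norm_sq \<phi>"
    unfolding functional_norm_sq_def by (rule SUP_subset_mono) auto
qed

lemma borel_measurable_functional_norm_sq:
  fixes \<phi> :: "'q \<Rightarrow> 'u::{real_inner, second_countable_topology} \<Rightarrow> real"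
  assumes "\<And>q. bounded_linear (\<phi> q)" "\<And>v. (\<lambda>q. \<phi> q v) \<in> borel_measurable N"
  shows "(\<lambda>q. functional_norm_sq (\<phi> q)) \<in> borel_measurable N"
proof -
  obtain D :: "'u set" where D: "countable D" "\<And>X. open X \<Longrightarrow> X \<noteq> {} \<Longrightarrow> \<exists>d\<in>D. d \<in> X"
    by (rule countable_dense_setE) blast
  have "closure D = UNIV"
    using D(2)[of "- closure D"] closure_subset[of D] by fastforce
  show ?thesis
    unfolding functional_norm_sq_eq_SUP_dense[OF assms(1) \<open>closure D = UNIV\<close>]
    using assms(2) by (intro borel_measurable_SUP[OF D(1)]) simp
qed

lemma functional_norm_sq_inner: "functional_norm_sq (\<lambda>v. v \<bullet> g) = ennreal ((norm g)\<^sup>2)"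
proof (rule antisym)
  show "functional_norm_sq (\<lambda>v. v \<bullet> g) \<le> ennreal ((norm g)\<^sup>2)"
  proof (rule functional_norm_sq_le_if_dense[OF bounded_linear_inner_left closure_UNIV])
    show "(v \<bullet> g)\<^sup>2 \<le> (norm g)\<^sup>2 * (norm v)\<^sup>2" for v
      using Cauchy_Schwarz_ineq[of v g] by (simp add: power2_norm_eq_inner mult.commute)
  qed simp
  have "(norm g)\<^sup>2 = (g \<bullet> g)\<^sup>2 / (norm g)\<^sup>2"
    by (cases "g = 0") (simp_all add: dot_square_norm power2_eq_square)
  then show "ennreal ((norm g)\<^sup>2) \<le> functional_norm_sq (\<lambda>v. v \<bullet> g)"
    unfolding functional_norm_sq_def by (intro SUP_upper2[of g]) auto
qed

text \<open>From (a + b)^2 \<le> 2 a^2 + 2 b^2. This crude triangle inequality avoids square roots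
  in \<open>ennreal\<close>; its price is the factor 2 in all later comparisons of
  variances.\<close>

lemma functional_norm_sq_add_le:
  assumes "\<And>v. \<rho> v = \<phi> v + \<psi> v"
  shows "functional_norm_sq \<rho> \<le> 2 * functional_norm_sq \<phi> + 2 * functional_norm_sq \<psi>"
  unfolding functional_norm_sq_def[of \<rho>]
proof (rule SUP_least)
  fix v :: 'a
  have "(\<phi> v + \<psi> v)\<^sup>2 \<le> 2 * (\<phi> v)\<^sup>2 + 2 * (\<psi> v)\<^sup>2"
    using zero_le_power2[of "\<phi> v - \<psi> v"] by (simp add: power2_eq_square algebra_simps)
  then have "(\<rho> v)\<^sup>2 / (norm v)\<^sup>2 \<le> 2 * ((\<phi> v)\<^sup>2 / (norm v)\<^sup>2) + 2 * ((\<psi> v)\<^sup>2 / (norm v)\<^sup>2)"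
    unfolding assms by (simp add: divide_right_mono flip: add_divide_distrib)
  then have "ennreal ((\<rho> v)\<^sup>2 / (norm v)\<^sup>2)
      \<le> 2 * ennreal ((\<phi> v)\<^sup>2 / (norm v)\<^sup>2) + 2 * ennreal ((\<psi> v)\<^sup>2 / (norm v)\<^sup>2)"
    by (simp add: ennreal_leI flip: ennreal_plus ennreal_mult ennreal_numeral)
  also have "\<dots> \<le> 2 * functional_norm_sq \<phi> + 2 * functional_norm_sq \<psi>"
    unfolding functional_norm_sq_def by (intro add_mono mult_left_mono SUP_upper) auto
  finally show "ennreal ((\<rho> v)\<^sup>2 / (norm v)\<^sup>2) \<le> \<dots>" .
qed

lemma functional_norm_sq_uminus: "functional_norm_sq (\<lambda>v. - \<phi> v) = functional_norm_sq \<phi>"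
  by (simp add: functional_norm_sq_def)

text \<open>On a finite combination of basis vectors Pythagoras gives the norm and Cauchy-Schwarz
  bounds the functional by any finite part of the sum; density of the span does the rest. The
  operator norm is thus at most the Hilbert-Schmidt norm.\<close>

lemma functional_norm_sq_le_orthonormal_sum:
  assumes \<phi>: "bounded_linear \<phi>" and E: "orthonormal_basis E"
  shows "functional_norm_sq \<phi> \<le> (\<integral>\<^sup>+e. ennreal ((\<phi> e)\<^sup>2) \<partial>count_space E)" (is "_ \<le> ?S")
proof (cases ?S)
  case (real K)
  have fin: "(\<Sum>e\<in>t. (\<phi> e)\<^sup>2) \<le> K" if t: "finite t" "t \<subseteq> E" for t
  proof -
    have "(\<Sum>e\<in>t. ennreal ((\<phi> e)\<^sup>2)) = (\<integral>\<^sup>+e. ennreal ((\<phi> e)\<^sup>2) * indicator t e \<partial>count_space E)"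
      by (subst nn_integral_count_space'[OF t(1) _ t(2)]) (auto intro!: sum.cong)
    also have "\<dots> \<le> ?S"
      by (intro nn_integral_mono) (auto simp: indicator_def)
    finally show ?thesis
      using real by (simp add: sum_nonneg)
  qed
  have "(\<phi> v)\<^sup>2 \<le> K * (norm v)\<^sup>2" if v: "v \<in> span E" for v
  proof -
    obtain t c where t: "finite t" "t \<subseteq> E" and v: "v = (\<Sum>e\<in>t. c e *\<^sub>R e)"
      using v unfolding span_explicit by blast
    have "norm (c e *\<^sub>R e) = \<bar>c e\<bar>" if "e \<in> t" for e
      using E t that by (auto simp: orthonormal_basis_def)
    moreover have "pairwise (\<lambda>e e'. orthogonal (c e *\<^sub>R e) (c e' *\<^sub>R e')) t"
      using pairwise_subset[OF _ t(2), of orthogonal] E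
      by (auto simp: orthonormal_basis_def pairwise_def orthogonal_def)
    ultimately have n: "(norm v)\<^sup>2 = (\<Sum>e\<in>t. (c e)\<^sup>2)"
      unfolding v by (subst norm_sum_Pythagorean[OF t(1)]) (auto intro!: sum.cong simp del: norm_scaleR)
    have "(\<phi> v)\<^sup>2 = (\<Sum>e\<in>t. c e * \<phi> e)\<^sup>2"
      unfolding v using linear_sum[OF bounded_linear.linear[OF \<phi>], of "\<lambda>e. c e *\<^sub>R e" t] linear_simps(5)[OF \<phi>] by simp
    also have "\<dots> \<le> (\<Sum>e\<in>t. (c e)\<^sup>2) * (\<Sum>e\<in>t. (\<phi> e)\<^sup>2)"
      by (rule Cauchy_Schwarz_ineq_sum)
    also have "\<dots> \<le> (norm v)\<^sup>2 * K"
      unfolding n by (intro mult_left_mono fin t sum_nonneg) auto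
    finally show ?thesis by (simp add: mult.commute)
  qed
  then show ?thesis
    unfolding real(2) using E real(1)
    by (intro functional_norm_sq_le_if_dense[OF \<phi>]) (auto simp: orthonormal_basis_def)
qed (simp only: top_greatest)

lemma sobolev_coeff_le_norm:
  assumes "a \<in> sobolev_space s"
  shows "sobolev_weight s k * (cmod (a k))\<^sup>2 \<le> (sobolev_norm s a)\<^sup>2"
proof -
  have "(\<Sum>j\<in>{k}. sobolev_weight s j * (cmod (a j))\<^sup>2) \<le> (\<Sum>\<^sub>\<infinity>j. sobolev_weight s j * (cmod (a j))\<^sup>2)"
    using assms by (intro finite_sum_le_infsum) (auto simp: sobolev_space_def)
  then show ?thesis by (simp add: sobolev_norm_def infsum_nonneg)
qed

text \<open>The infimum over bases in \<open>hs_norm_sq\<close> calls for a bound that holds for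
  each basis, and the operator norm supplies one without any comparison of bases. In this way
  Hilbert-Schmidt convergence of integrands descends to a real functional of a single mode.\<close>

lemma functional_norm_sq_le_hs_norm_sq:
  assumes T: "\<And>u. T u \<in> sobolev_space s" and c: "norm c = 1"
    and bl: "bounded_linear (\<lambda>u. Re (c * T u k))"
  shows "ennreal (sobolev_weight s k) * functional_norm_sq (\<lambda>u. Re (c * T u k)) \<le> hs_norm_sq s T"
  unfolding hs_norm_sq_def
proof (rule INF_greatest)
  fix E :: "'a set" assume "E \<in> {E. orthonormal_basis E}"
  then have E: "orthonormal_basis E" by simp
  have le: "sobolev_weight s k * (Re (c * T e k))\<^sup>2 \<le> (sobolev_norm s (T e))\<^sup>2" for e
  proof -
    have "\<bar>Re (c * T e k)\<bar> \<le> cmod (T e k)"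
      using abs_Re_le_cmod[of "c * T e k"] c by (simp only: norm_mult)
    then have "(Re (c * T e k))\<^sup>2 \<le> (cmod (T e k))\<^sup>2"
      by (simp only: abs_le_square_iff[symmetric] abs_norm_cancel)
    then show ?thesis
      using sobolev_coeff_le_norm[OF T, of k e] by (meson mult_left_mono order_trans sobolev_weight_nonneg)
  qed
  have "ennreal (sobolev_weight s k) * functional_norm_sq (\<lambda>u. Re (c * T u k))
      \<le> ennreal (sobolev_weight s k) * (\<integral>\<^sup>+e. ennreal ((Re (c * T e k))\<^sup>2) \<partial>count_space E)"
    by (intro mult_left_mono functional_norm_sq_le_orthonormal_sum bl E) auto
  also have "\<dots> = (\<integral>\<^sup>+e. ennreal (sobolev_weight s k) * ennreal ((Re (c * T e k))\<^sup>2) \<partial>count_space E)"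
    by (rule nn_integral_cmult[symmetric]) auto
  also have "\<dots> \<le> (\<integral>\<^sup>+e. ennreal ((sobolev_norm s (T e))\<^sup>2) \<partial>count_space E)"
    using le by (intro nn_integral_mono) (simp add: ennreal_leI flip: ennreal_mult)
  finally show "ennreal (sobolev_weight s k) * functional_norm_sq (\<lambda>u. Re (c * T u k)) \<le> \<dots>" .
qed

section \<open>Fourier coefficients as Borel functions on a Sobolev space\<close>

lemma sobolev_topology_openin_coeff:
  assumes "open U"
  shows "openin (sobolev_topology s) {a \<in> sobolev_space s. a k \<in> U}"
proof -
  interpret Metric_space "sobolev_space s" "sobolev_dist s"
    by (rule Metric_space_sobolev)
  have w: "sobolev_weight s k > 0" by (rule sobolev_weight_pos)
  show ?thesis
    unfolding sobolev_topology_def openin_mtopology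
  proof safe
    fix a assume a: "a \<in> sobolev_space s" "a k \<in> U"
    then obtain e where e: "e > 0" "\<And>z. dist z (a k) < e \<Longrightarrow> z \<in> U"
      using assms by (meson open_dist)
    show "\<exists>r>0. mball a r \<subseteq> {a \<in> sobolev_space s. a k \<in> U}"
    proof (intro exI conjI subsetI)
      show "sqrt (sobolev_weight s k) * e > 0" using w e by simp
      fix b assume "b \<in> mball a (sqrt (sobolev_weight s k) * e)"
      then have b: "b \<in> sobolev_space s" "sobolev_dist s b a < sqrt (sobolev_weight s k) * e"
        by (auto simp: commute)
      have "(sqrt (sobolev_weight s k) * cmod (b k - a k))\<^sup>2 \<le> (sobolev_dist s b a)\<^sup>2"
        using sobolev_coeff_le_norm[OF sobolev_space_diff[OF b(1) a(1)], of k]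
        by (simp only: sobolev_dist_def power_mult_distrib real_sqrt_pow2 sobolev_weight_nonneg)
      then have "sqrt (sobolev_weight s k) * cmod (b k - a k) \<le> sobolev_dist s b a"
        by (rule power2_le_imp_le) simp
      then have "sqrt (sobolev_weight s k) * cmod (b k - a k) < sqrt (sobolev_weight s k) * e"
        using b(2) by (rule order_le_less_trans)
      then have "dist (b k) (a k) < e"
        using w by (simp add: dist_norm)
      then show "b \<in> {a \<in> sobolev_space s. a k \<in> U}" using b e by auto
    qed
  qed
qed

lemma space_sobolev_borel: "space (sobolev_borel s) = sobolev_space s"
  by (simp add: sobolev_borel_def space_measure_of_conv)

lemma measurable_sobolev_coeff: "(\<lambda>a. a k) \<in> borel_measurable (sobolev_borel s)"
proof (rule borel_measurableI)
  fix U :: "complex set" assume "open U"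
  from sobolev_topology_openin_coeff[OF this, of s k]
  have "{a \<in> sobolev_space s. a k \<in> U} \<in> sets (sobolev_borel s)"
    unfolding sobolev_borel_def
    using openin_subset[of "sobolev_topology s"] topspace_sobolev[of s]
    by (subst sets_measure_of) (blast intro: sigma_sets.Basic)+
  moreover have "(\<lambda>a. a k) -` U \<inter> space (sobolev_borel s) = {a \<in> sobolev_space s. a k \<in> U}"
    by (auto simp: space_sobolev_borel)
  ultimately show "(\<lambda>a. a k) -` U \<inter> space (sobolev_borel s) \<in> sets (sobolev_borel s)" by simp
qed

section \<open>Gaussian laws of Fourier modes\<close>

text \<open>The common refinement of all endpoints of a step integrand. The grid stays constant
  after index \<open>m\<close>, so it is increasing on all of \<open>nat\<close> but strictly so
  only up to \<open>m\<close>.\<close>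

lemma sorted_grid_exists:
  fixes a b :: real
  assumes S: "finite S" "a \<in> S" "b \<in> S" "\<And>x. x \<in> S \<Longrightarrow> a \<le> x \<and> x \<le> b"
  obtains t :: "nat \<Rightarrow> real" and m where "incseq t" "t 0 = a" "t m = b"
    "\<And>i j. i < j \<Longrightarrow> j \<le> m \<Longrightarrow> t i < t j" "S \<subseteq> t ` {..m}"
proof -
  define xs where "xs = sorted_list_of_set S"
  define m where "m = length xs - 1"
  define t where "t j = xs ! min j m" for j
  have xs: "set xs = S" "sorted_wrt (<) xs" "xs \<noteq> []"
    using S by (auto simp: xs_def)
  then have len: "length xs = Suc m" by (cases xs) (auto simp: m_def)
  have strict: "t i < t j" if "i < j" "j \<le> m" for i j
    using that len sorted_wrt_nth_less[OF xs(2)] by (simp add: t_def)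
  have im: "t ` {..m} = S"
  proof -
    have "S = (\<lambda>i. xs ! i) ` {..<Suc m}"
      using xs(1) len by (auto simp: set_conv_nth image_iff)
    then show ?thesis by (auto simp: t_def image_iff lessThan_Suc_atMost)
  qed
  have inc: "incseq t"
  proof (rule incseq_SucI)
    show "t n \<le> t (Suc n)" for n
      using strict[of n "Suc n"] by (cases "n < m") (auto simp: t_def)
  qed
  have "t 0 = a"
  proof -
    obtain i where "t i = a" using im S(2) by blast
    moreover have "t 0 \<in> S" using im by blast
    ultimately show ?thesis using S(4)[of "t 0"] incseqD[OF inc, of 0 i] by simp
  qed
  moreover have "t m = b"
  proof -
    obtain i where "t i = b" "i \<le> m" using im S(3) by blast
    moreover have "t m \<in> S" using im by blast
    ultimately show ?thesis using S(4)[of "t m"] incseqD[OF inc, of i m] by simp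
  qed
  ultimately show thesis using that inc strict im by blast
qed

text \<open>An increment over (r, r'] is the sum over the cells inside it. With \<open>H\<close> a
  path of the noise this splits the step integral, with \<open>H\<close> the indicator of {..y} at a
  fixed time, as a function of y, it splits the step operator, so both are expanded with the same
  cell coefficients.\<close>

lemma grid_telescope:
  fixes t :: "nat \<Rightarrow> real" and H :: "real \<Rightarrow> 'v::real_vector"
  assumes strict: "\<And>i j. i < j \<Longrightarrow> j \<le> m \<Longrightarrow> t i < t j"
    and r: "r \<in> t ` {..m}" "r' \<in> t ` {..m}" "r \<le> r'"
  shows "(\<Sum>j<m. (if r \<le> t j \<and> t (Suc j) \<le> r' then 1 else 0) *\<^sub>R (H (t (Suc j)) - H (t j))) = H r' - H r"
proof -
  have le: "t i \<le> t j \<longleftrightarrow> i \<le> j" if "i \<le> m" "j \<le> m" for i j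
    using strict[of i j] strict[of j i] that by (metis le_less not_le order_less_imp_le)
  obtain p q where pq: "r = t p" "p \<le> m" "r' = t q" "q \<le> m" using r by auto
  then have "p \<le> q" using le r(3) by simp
  have "(\<Sum>j<m. (if r \<le> t j \<and> t (Suc j) \<le> r' then 1 else 0) *\<^sub>R (H (t (Suc j)) - H (t j)))
      = (\<Sum>j\<in>{p..<q}. H (t (Suc j)) - H (t j))"
    using pq by (intro sum.mono_neutral_cong_right) (auto simp: le Suc_le_eq)
  also have "\<dots> = H r' - H r"
    using sum_Suc_diff'[OF \<open>p \<le> q\<close>, of "\<lambda>j. H (t j)"] pq by simp
  finally show ?thesis .
qed

lemma sum_list_sum_swap:
  "(\<Sum>x\<leftarrow>G. \<Sum>j\<in>J. f x j) = (\<Sum>j\<in>J. \<Sum>x\<leftarrow>G. f x j :: 'b::comm_monoid_add)"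
  by (induction G) (auto simp: sum.distrib)

locale cylindrical_wiener_space =
  fixes M :: "'w measure" and F :: "real \<Rightarrow> 'w measure"
    and W :: "real \<Rightarrow> 'u::{real_inner, second_countable_topology} \<Rightarrow> 'w \<Rightarrow> real"
  assumes filtered: "usual_filtered_prob_space M F" and wiener: "cylindrical_wiener M F W"
begin

sublocale prob_space M
  using filtered[unfolded usual_filtered_prob_space_def, THEN conjunct1] .

lemma subalg: "t \<ge> 0 \<Longrightarrow> subalgebra M (F t)"
  using filtered[unfolded usual_filtered_prob_space_def, THEN conjunct2, THEN conjunct1] by blast

lemma space_F: "t \<ge> 0 \<Longrightarrow> space (F t) = space M"
  using subalg by (simp add: subalgebra_def)

lemma sets_F_subset: "t \<ge> 0 \<Longrightarrow> sets (F t) \<subseteq> events"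
  using subalg by (simp add: subalgebra_def)

lemma sets_F_mono: "0 \<le> s \<Longrightarrow> s \<le> t \<Longrightarrow> sets (F s) \<subseteq> sets (F t)"
  using filtered[unfolded usual_filtered_prob_space_def, THEN conjunct2, THEN conjunct2, THEN conjunct1] by blast

lemma measurable_F: "f \<in> measurable (F t) N \<Longrightarrow> t \<ge> 0 \<Longrightarrow> f \<in> measurable M N"
  using measurable_from_subalg[OF subalg] by blast

lemma measurable_F_mono:
  assumes "f \<in> measurable (F s) N" "0 \<le> s" "s \<le> t"
  shows "f \<in> measurable (F t) N"
proof (rule measurable_from_subalg[OF _ assms(1)])
  show "subalgebra (F t) (F s)"
    using assms sets_F_mono[of s t] space_F by (simp add: subalgebra_def)
qed

text \<open>The definition of \<^const>\<open>cylindrical_wiener\<close> leaves \<open>W t 0\<close> unspecified on a null set.\<close>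

definition W' :: "real \<Rightarrow> 'u \<Rightarrow> 'w \<Rightarrow> real" where
  "W' t u \<omega> = (if u = 0 then 0 else W t u \<omega>)"

lemma W'_AE:
  assumes "t \<ge> 0"
  shows "AE \<omega> in M. W' t u \<omega> = W t u \<omega>"
proof -
  \<comment> \<open>Linearity at 0 + 0 says that \<open>W t 0\<close> equals its own double, so it
    vanishes almost surely.\<close>
  have "AE \<omega> in M. W t (1 *\<^sub>R 0 + 0) \<omega> = 1 * W t 0 \<omega> + W t 0 \<omega>"
    using wiener assms unfolding cylindrical_wiener_def by blast
  then show ?thesis by (auto simp: W'_def)
qed

lemma W'_linear:
  assumes t: "t \<ge> 0"
  shows "AE \<omega> in M. W' t (c *\<^sub>R u + v) \<omega> = c * W' t u \<omega> + W' t v \<omega>"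
proof -
  have "AE \<omega> in M. W t (c *\<^sub>R u + v) \<omega> = c * W t u \<omega> + W t v \<omega>"
    using wiener t unfolding cylindrical_wiener_def by blast
  with W'_AE[OF t, of "c *\<^sub>R u + v"] W'_AE[OF t, of u] W'_AE[OF t, of v] show ?thesis
    by eventually_elim simp
qed

lemma W'_sum_list:
  assumes t: "t \<ge> 0"
  shows "AE \<omega> in M. W' t (\<Sum>p\<leftarrow>G. c p *\<^sub>R e p) \<omega> = (\<Sum>p\<leftarrow>G. c p * W' t (e p) \<omega>)"
proof (induction G)
  case Nil
  then show ?case by (simp add: W'_def)
next
  case (Cons p G)
  with W'_linear[OF t, of "c p" "e p" "\<Sum>p\<leftarrow>G. c p *\<^sub>R e p"] show ?case
    by eventually_elim simp
qed

lemma W'_measurable: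
  assumes "0 \<le> s" "s \<le> t"
  shows "W' s u \<in> borel_measurable (F t)"
proof (cases "u = 0")
  case True
  then have "W' s u = (\<lambda>_. 0)" by (simp add: W'_def fun_eq_iff)
  then show ?thesis by simp
next
  case False
  then have "W' s u = W s u" by (simp add: W'_def fun_eq_iff)
  moreover have "W s u \<in> borel_measurable (F s)"
    using wiener False assms(1) unfolding cylindrical_wiener_def brownian_motion_def by blast
  ultimately show ?thesis
    using assms by (simp only: measurable_F_mono)
qed

text \<open>A general bounded complex \<open>Y\<close> from the past is allowed so that exponentials
  of earlier increments can take its place. The cases \<open>u = 0\<close> and \<open>s = t\<close>,
  which the definitions of the noise exclude, hold because the increment of \<open>W'\<close> is
  then 0.\<close>

lemma increment_char:
  assumes st: "0 \<le> s" "s \<le> t" and Y: "Y \<in> borel_measurable (F s)" "\<And>\<omega>. norm (Y \<omega>) \<le> 1"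
  shows "(\<integral>\<omega>. Y \<omega> * iexp (\<theta> * (W' t u \<omega> - W' s u \<omega>)) \<partial>M)
     = (\<integral>\<omega>. Y \<omega> \<partial>M) * of_real (exp (- (\<theta>\<^sup>2 * ((t - s) * (norm u)\<^sup>2) / 2)))"
proof (cases "u = 0 \<or> s = t")
  case True
  then show ?thesis by (auto simp: W'_def)
next
  case False
  define X where "X \<omega> = W t u \<omega> - W s u \<omega>" for \<omega>
  define d where "d = norm u * sqrt (t - s)"
  have "d > 0" using False st by (simp add: d_def)
  have bm: "brownian_motion M F (norm u) (\<lambda>t. W t u)"
    using wiener False by (simp add: cylindrical_wiener_def)
  then have indep: "indep_set (sets (F s)) {X -` A \<inter> space M | A. A \<in> sets borel}"
    and distr: "distributed M lborel X (normal_density 0 d)"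
    using False st by (auto simp: brownian_motion_def X_def[abs_def] d_def)
  have X: "X \<in> borel_measurable M"
    using distributed_measurable[OF distr] by simp
  have eX: "(\<lambda>\<omega>. iexp (\<theta> * X \<omega>)) \<in> borel_measurable M"
    using X by measurable
  have YM: "Y \<in> borel_measurable M"
    using Y(1) st(1) by (rule measurable_F)
  have "indep_var borel Y borel (\<lambda>\<omega>. iexp (\<theta> * X \<omega>))"
    unfolding indep_var_eq
  proof (intro conjI YM eX)
    have 1: "sigma_sets (space M) {Y -` A \<inter> space M | A. A \<in> sets borel} \<subseteq> sets (F s)"
      using measurable_sets[OF Y(1)] space_F[OF st(1)]
      by (auto intro!: sets.sigma_sets_subset[of _ "F s", unfolded space_F[OF st(1)]])
    have vX: "sets (vimage_algebra (space M) X borel) = {X -` A \<inter> space M | A. A \<in> sets borel}"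
      by (subst sets_vimage_algebra2) auto
    have 2: "sigma_sets (space M) {(\<lambda>\<omega>. iexp (\<theta> * X \<omega>)) -` A \<inter> space M | A. A \<in> sets borel}
        \<subseteq> {X -` A \<inter> space M | A. A \<in> sets borel}"
      unfolding vX[symmetric]
    proof (rule sets.sigma_sets_subset[of _ "vimage_algebra (space M) X borel", simplified space_vimage_algebra], safe)
      fix A :: "complex set" assume "A \<in> sets borel"
      then have "(\<lambda>x. iexp (\<theta> * x)) -` A \<inter> space borel \<in> sets (borel :: real measure)"
        by (intro measurable_sets[of _ borel borel]) auto
      moreover have "(\<lambda>\<omega>. iexp (\<theta> * X \<omega>)) -` A \<inter> space M = X -` ((\<lambda>x. iexp (\<theta> * x)) -` A \<inter> space borel) \<inter> space M"
        by auto
      ultimately show "(\<lambda>\<omega>. iexp (\<theta> * X \<omega>)) -` A \<inter> space M \<in> sets (vimage_algebra (space M) X borel)"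
        unfolding vX by blast
    qed
    show "indep_set (sigma_sets (space M) {Y -` A \<inter> space M | A. A \<in> sets borel})
       (sigma_sets (space M) {(\<lambda>\<omega>. iexp (\<theta> * X \<omega>)) -` A \<inter> space M | A. A \<in> sets borel})"
      unfolding indep_set_def
      by (rule indep_sets_mono_sets[OF indep[unfolded indep_set_def]]) (use 1 2 in \<open>auto split: bool.split\<close>)
  qed
  then have "(\<integral>\<omega>. Y \<omega> * iexp (\<theta> * X \<omega>) \<partial>M) = (\<integral>\<omega>. Y \<omega> \<partial>M) * (\<integral>\<omega>. iexp (\<theta> * X \<omega>) \<partial>M)"
  proof (rule indep_var_lebesgue_integral)
    show "integrable M Y"
      using Y(2) by (intro integrable_const_bound[where B = 1] YM) auto
    show "integrable M (\<lambda>\<omega>. iexp (\<theta> * X \<omega>))"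
      by (intro integrable_const_bound[where B = 1] eX) auto
  qed
  also have "(\<integral>\<omega>. iexp (\<theta> * X \<omega>) \<partial>M) = of_real (exp (- (\<theta>\<^sup>2 * ((t - s) * (norm u)\<^sup>2) / 2)))"
  proof -
    have "distributed M lborel (\<lambda>\<omega>. (X \<omega> - 0) / d) std_normal_density"
      using distr normal_standard_normal_convert[OF \<open>d > 0\<close>, of X 0] by blast
    then have D: "distr M lborel (\<lambda>\<omega>. X \<omega> / d) = std_normal_distribution"
      by (simp add: distributed_def)
    have "(\<integral>\<omega>. iexp (\<theta> * X \<omega>) \<partial>M) = (\<integral>\<omega>. iexp ((\<theta> * d) * (X \<omega> / d)) \<partial>M)"
      using \<open>d > 0\<close> by simp
    also have "\<dots> = (\<integral>x. iexp ((\<theta> * d) * x) \<partial>distr M lborel (\<lambda>\<omega>. X \<omega> / d))"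
      using X by (subst integral_distr) auto
    also have "\<dots> = char std_normal_distribution (\<theta> * d)"
      unfolding D by (simp add: char_def)
    also have "\<dots> = of_real (exp (- (\<theta>\<^sup>2 * ((t - s) * (norm u)\<^sup>2) / 2)))"
    proof -
      have "(\<theta> * d)\<^sup>2 = \<theta>\<^sup>2 * ((t - s) * (norm u)\<^sup>2)"
        using st by (simp add: d_def power_mult_distrib)
      then show ?thesis
        by (simp only: char_std_normal_distribution minus_divide_left)
    qed
    finally show ?thesis .
  qed
  finally show ?thesis using False by (simp add: X_def W'_def)
qed

lemma grid_measurable:
  assumes t: "incseq t" "0 \<le> t 0"
  shows "(\<lambda>\<omega>. \<Sum>j<m. W' (t (Suc j)) (U j) \<omega> - W' (t j) (U j) \<omega>) \<in> borel_measurable (F (t m))"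
proof (intro borel_measurable_sum borel_measurable_diff W'_measurable)
  fix j assume "j \<in> {..<m}"
  then show "0 \<le> t (Suc j)" "t (Suc j) \<le> t m" "0 \<le> t j" "t j \<le> t m"
    using t(2) incseqD[OF t(1), of 0 j] incseqD[OF t(1), of 0 "Suc j"]
      incseqD[OF t(1), of j m] incseqD[OF t(1), of "Suc j" m] by auto
qed

text \<open>Induction over the cells: the indicator of \<open>A\<close> times the exponential of the
  earlier increments is measurable at time \<open>t m\<close> and of modulus at most 1, so it acts
  as the past factor in \<open>increment_char\<close>. Ranging over all \<open>A\<close> and
  \<theta>, the identity says that the sum is a centred Gaussian independent of
  \<open>F (t 0)\<close>.\<close>

lemma grid_char:
  assumes t: "incseq t" "0 \<le> t 0" and A: "A \<in> sets (F (t 0))"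
  shows "(\<integral>\<omega>. indicator A \<omega> * iexp (\<theta> * (\<Sum>j<m. W' (t (Suc j)) (U j) \<omega> - W' (t j) (U j) \<omega>)) \<partial>M)
     = of_real (prob A * exp (- (\<theta>\<^sup>2 * (\<Sum>j<m. (t (Suc j) - t j) * (norm (U j))\<^sup>2) / 2)))"
proof (induction m)
  case 0
  have "A \<in> events" using A sets_F_subset t(2) by blast
  moreover have "(indicator A :: 'w \<Rightarrow> complex) = (\<lambda>\<omega>. of_real (indicator A \<omega>))"
    by (auto simp: indicator_def)
  ultimately show ?case by simp
next
  case (Suc m)
  define S where "S \<omega> = (\<Sum>j<m. W' (t (Suc j)) (U j) \<omega> - W' (t j) (U j) \<omega>)" for \<omega>
  have t0: "0 \<le> t m" "t m \<le> t (Suc m)" and Am: "A \<in> sets (F (t m))"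
    using t incseqD[OF t(1), of 0 m] incseqD[OF t(1), of m "Suc m"] A sets_F_mono[of "t 0" "t m"] by auto
  have S: "S \<in> borel_measurable (F (t m))"
    unfolding S_def[abs_def] by (rule grid_measurable[OF t])
  have "(\<integral>\<omega>. (indicator A \<omega> * iexp (\<theta> * S \<omega>)) * iexp (\<theta> * (W' (t (Suc m)) (U m) \<omega> - W' (t m) (U m) \<omega>)) \<partial>M)
      = (\<integral>\<omega>. indicator A \<omega> * iexp (\<theta> * S \<omega>) \<partial>M)
         * of_real (exp (- (\<theta>\<^sup>2 * ((t (Suc m) - t m) * (norm (U m))\<^sup>2) / 2)))"
  proof (rule increment_char[OF t0])
    show "(\<lambda>\<omega>. indicator A \<omega> * iexp (\<theta> * S \<omega>)) \<in> borel_measurable (F (t m))"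
      using S Am by measurable
  qed (auto simp: norm_mult indicator_def)
  also have "\<dots> = of_real (prob A * (exp (- (\<theta>\<^sup>2 * (\<Sum>j<m. (t (Suc j) - t j) * (norm (U j))\<^sup>2) / 2))
      * exp (- (\<theta>\<^sup>2 * ((t (Suc m) - t m) * (norm (U m))\<^sup>2) / 2))))"
    using Suc.IH by (simp only: S_def mult.assoc of_real_mult)
  also have "\<dots> = of_real (prob A * exp (- (\<theta>\<^sup>2 * (\<Sum>j<Suc m. (t (Suc j) - t j) * (norm (U j))\<^sup>2) / 2)))"
    by (simp only: exp_add[symmetric] sum.lessThan_Suc distrib_left add_divide_distrib minus_add_distrib)
  finally show ?case
    by (simp only: S_def mult.assoc exp_add[symmetric] distrib_left[symmetric] of_real_add[symmetric] sum.lessThan_Suc)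
qed

text \<open>On one grid cell all rank-one terms act simultaneously, and the chosen functional of
  their sum is the inner product with a single vector \<open>U j\<close>. The integral is then a sum
  of increments in the directions \<open>U j\<close>, and its variance is exactly the time integral
  of the squared functional norm, a scalar Ito isometry.\<close>

lemma step_integral_gaussian:
  assumes G: "step_integrand s a b G" and ab: "0 \<le> a" "a \<le> b"
  obtains \<zeta> V where "\<zeta> \<in> borel_measurable (F b)"
    and "AE \<omega> in M. \<zeta> \<omega> = Re (c * step_integral W G \<omega> k)"
    and "V \<ge> 0"
    and "(\<integral>\<^sup>+q\<in>{a..b}. functional_norm_sq (\<lambda>v. Re (c * step_op G q v k)) \<partial>lborel) = ennreal V"
    and "\<And>A \<theta>. A \<in> sets (F a) \<Longrightarrow>
       (\<integral>\<omega>. indicator A \<omega> * iexp (\<theta> * \<zeta> \<omega>) \<partial>M) = of_real (prob A * exp (- (\<theta>\<^sup>2 * V / 2)))"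
proof -
  have GE: "a \<le> r \<and> r \<le> r' \<and> r' \<le> b" if "(r, r', u, x) \<in> set G" for r r' u x
    using G that by (auto simp: step_integrand_def)
  define S where "S = {a, b} \<union> (\<lambda>(r, r', u, x). r) ` set G \<union> (\<lambda>(r, r', u, x). r') ` set G"
  have "finite S" "a \<in> S" "b \<in> S" "\<And>x. x \<in> S \<Longrightarrow> a \<le> x \<and> x \<le> b"
    using GE ab by (fastforce simp: S_def)+
  from sorted_grid_exists[OF this] obtain t m where t: "incseq t" "t 0 = a" "t m = b"
    and strict: "\<And>i j. i < j \<Longrightarrow> j \<le> m \<Longrightarrow> t i < t j" and St: "S \<subseteq> t ` {..m}"
    by blast
  define \<kappa> :: "real \<Rightarrow> real \<Rightarrow> nat \<Rightarrow> real"
    where "\<kappa> r r' j = (if r \<le> t j \<and> t (Suc j) \<le> r' then 1 else 0)" for r r' j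
  define \<eta> where "\<eta> x = Re (c * x k)" for x :: coeffs
  \<comment> \<open>The terms are merged before increments are taken: different entries may be
    active on the same cell, and their increments there are in general correlated.\<close>
  define U where "U j = (\<Sum>(r, r', u, x)\<leftarrow>G. (\<kappa> r r' j * \<eta> x) *\<^sub>R u)" for j
  define \<zeta> where "\<zeta> \<omega> = (\<Sum>j<m. W' (t (Suc j)) (U j) \<omega> - W' (t j) (U j) \<omega>)" for \<omega>
  define V where "V = (\<Sum>j<m. (t (Suc j) - t j) * (norm (U j))\<^sup>2)"
  have tele: "(\<Sum>j<m. \<kappa> r r' j *\<^sub>R (H (t (Suc j)) - H (t j))) = H r' - H r"
    if "(r, r', u, x) \<in> set G" for r r' u x and H :: "real \<Rightarrow> real"
    unfolding \<kappa>_def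
  proof (rule grid_telescope[OF strict])
    have "r \<in> S" "r' \<in> S"
      using that by (force simp: S_def)+
    then show "r \<in> t ` {..m}" "r' \<in> t ` {..m}" using St by auto
    show "r \<le> r'" using GE[OF that] by simp
  qed
  have t_nonneg: "t j \<ge> 0" for j
    using incseqD[OF t(1), of 0 j] t(2) ab by simp

  have \<zeta>_AE: "AE \<omega> in M. \<zeta> \<omega> = Re (c * step_integral W G \<omega> k)"
  proof -
    have lin: "AE \<omega> in M. W' \<tau> (U j) \<omega> = (\<Sum>(r, r', u, x)\<leftarrow>G. \<kappa> r r' j * \<eta> x * W' \<tau> u \<omega>)" if "\<tau> \<ge> 0" for \<tau> j
      using W'_sum_list[OF that, where G = G and c = "\<lambda>(r, r', u, x). \<kappa> r r' j * \<eta> x" and e = "\<lambda>(r, r', u, x). u"]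
      by (simp add: U_def case_prod_unfold)
    have 1: "AE \<omega> in M. \<forall>j<m. W' (t j) (U j) \<omega> = (\<Sum>(r, r', u, x)\<leftarrow>G. \<kappa> r r' j * \<eta> x * W' (t j) u \<omega>)
        \<and> W' (t (Suc j)) (U j) \<omega> = (\<Sum>(r, r', u, x)\<leftarrow>G. \<kappa> r r' j * \<eta> x * W' (t (Suc j)) u \<omega>)"
      using lin t_nonneg by (auto simp: AE_all_countable)
    have 2: "AE \<omega> in M. \<forall>p\<in>set G. case p of (r, r', u, x) \<Rightarrow> W' r u \<omega> = W r u \<omega> \<and> W' r' u \<omega> = W r' u \<omega>"
    proof (rule AE_finite_allI)
      fix p assume "p \<in> set G"
      moreover obtain r r' u x where p: "p = (r, r', u, x)" by (cases p)
      ultimately have "r \<ge> 0" "r' \<ge> 0" using GE[of r r' u x] ab by auto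
      from W'_AE[OF this(1), of u] W'_AE[OF this(2), of u]
      show "AE \<omega> in M. case p of (r, r', u, x) \<Rightarrow> W' r u \<omega> = W r u \<omega> \<and> W' r' u \<omega> = W r' u \<omega>"
        unfolding p by eventually_elim simp
    qed simp
    from 1 2 show ?thesis
    proof eventually_elim
      case (elim \<omega>)
      have "\<zeta> \<omega> = (\<Sum>j<m. \<Sum>(r, r', u, x)\<leftarrow>G. \<kappa> r r' j * \<eta> x * (W' (t (Suc j)) u \<omega> - W' (t j) u \<omega>))"
        unfolding \<zeta>_def using elim(1)
        by (intro sum.cong) (auto simp: case_prod_unfold right_diff_distrib simp flip: sum_list_subtractf)
      also have "\<dots> = (\<Sum>(r, r', u, x)\<leftarrow>G. \<Sum>j<m. \<kappa> r r' j * \<eta> x * (W' (t (Suc j)) u \<omega> - W' (t j) u \<omega>))"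
        by (simp add: case_prod_unfold sum_list_sum_swap)
      also have "\<dots> = (\<Sum>(r, r', u, x)\<leftarrow>G. \<eta> x * (W r' u \<omega> - W r u \<omega>))"
      proof (intro arg_cong[where f = sum_list] map_cong refl)
        fix p assume p: "p \<in> set G"
        obtain r r' u x where p': "p = (r, r', u, x)" by (cases p)
        have "(\<Sum>j<m. \<kappa> r r' j * \<eta> x * (W' (t (Suc j)) u \<omega> - W' (t j) u \<omega>))
            = \<eta> x * (\<Sum>j<m. \<kappa> r r' j *\<^sub>R (W' (t (Suc j)) u \<omega> - W' (t j) u \<omega>))"
          by (simp add: sum_distrib_left mult_ac)
        also have "\<dots> = \<eta> x * (W r' u \<omega> - W r u \<omega>)"
          using tele[of r r' u x "\<lambda>\<tau>. W' \<tau> u \<omega>"] elim(2) p by (force simp: p')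
        finally show "(case p of (r, r', u, x) \<Rightarrow> \<Sum>j<m. \<kappa> r r' j * \<eta> x * (W' (t (Suc j)) u \<omega> - W' (t j) u \<omega>))
            = (case p of (r, r', u, x) \<Rightarrow> \<eta> x * (W r' u \<omega> - W r u \<omega>))"
          by (simp add: p')
      qed
      also have "\<dots> = Re (c * step_integral W G \<omega> k)"
        unfolding step_integral_def \<eta>_def by (induction G) (auto simp: algebra_simps)
      finally show ?case .
    qed
  qed

  have op: "Re (c * step_op G q v k) = v \<bullet> (\<Sum>j<m. indicator {t j<..t (Suc j)} q *\<^sub>R U j)" for q v
  proof -
    have ind: "indicator {r<..r'} q = (\<Sum>j<m. \<kappa> r r' j * indicator {t j<..t (Suc j)} q)"
      if "(r, r', u, x) \<in> set G" for r r' u x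
    proof -
      have i: "(indicator {x<..y} q :: real) = indicator {..y} q - indicator {..x} q" if "x \<le> y" for x y
        using that by (auto simp: indicator_def)
      have "indicator {t j<..t (Suc j)} q = (indicator {..t (Suc j)} q - indicator {..t j} q :: real)" for j
        using i[OF incseqD[OF t(1), of j "Suc j"]] by simp
      then show ?thesis
        using tele[OF that, of "\<lambda>y. indicator {..y} q"] GE[OF that] i[of r r'] by simp
    qed
    have "Re (c * step_op G q v k) = (\<Sum>(r, r', u, x)\<leftarrow>G. indicator {r<..r'} q * (\<eta> x * (v \<bullet> u)))"
      unfolding step_op_def \<eta>_def by (induction G) (auto simp: algebra_simps)
    also have "\<dots> = (\<Sum>(r, r', u, x)\<leftarrow>G. \<Sum>j<m. indicator {t j<..t (Suc j)} q * (\<kappa> r r' j * \<eta> x * (v \<bullet> u)))"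
    proof (intro arg_cong[where f = sum_list] map_cong refl)
      fix p assume p: "p \<in> set G"
      obtain r r' u x where p': "p = (r, r', u, x)" by (cases p)
      show "(case p of (r, r', u, x) \<Rightarrow> indicator {r<..r'} q * (\<eta> x * (v \<bullet> u)))
          = (case p of (r, r', u, x) \<Rightarrow> \<Sum>j<m. indicator {t j<..t (Suc j)} q * (\<kappa> r r' j * \<eta> x * (v \<bullet> u)))"
        using p unfolding p' prod.case
        by (simp only: ind sum_distrib_right) (intro sum.cong refl, simp only: mult_ac)
    qed
    also have "\<dots> = (\<Sum>j<m. \<Sum>(r, r', u, x)\<leftarrow>G. indicator {t j<..t (Suc j)} q * (\<kappa> r r' j * \<eta> x * (v \<bullet> u)))"
      by (simp only: case_prod_unfold sum_list_sum_swap)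
    also have "\<dots> = (\<Sum>j<m. indicator {t j<..t (Suc j)} q * (v \<bullet> U j))"
    proof (intro sum.cong refl)
      fix j
      show "(\<Sum>(r, r', u, x)\<leftarrow>G. indicator {t j<..t (Suc j)} q * (\<kappa> r r' j * \<eta> x * (v \<bullet> u))) = indicator {t j<..t (Suc j)} q * (v \<bullet> U j)"
        unfolding U_def by (induction G) (auto simp: inner_add_right algebra_simps)
    qed
    finally show ?thesis by (simp add: inner_sum_right)
  qed

  have var: "(\<integral>\<^sup>+q\<in>{a..b}. functional_norm_sq (\<lambda>v. Re (c * step_op G q v k)) \<partial>lborel) = ennreal V"
  proof -
    let ?I = "\<lambda>j. {t j<..t (Suc j)}"
    have disj: "i = j" if "q \<in> ?I i" "q \<in> ?I j" for q i j
      using that incseqD[OF t(1), of "Suc i" j] incseqD[OF t(1), of "Suc j" i]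
      by (cases i j rule: linorder_cases) auto
    \<comment> \<open>The cells are disjoint, so at most one vector \<open>U j\<close> is active at
      time \<open>q\<close> and the squared norm of the sum has no cross terms.\<close>
    have pt: "functional_norm_sq (\<lambda>v. Re (c * step_op G q v k)) * indicator {a..b} q
        = (\<Sum>j<m. ennreal ((norm (U j))\<^sup>2) * indicator (?I j) q)" for q
    proof (cases "\<exists>i<m. q \<in> ?I i")
      case True
      then obtain i where i: "i < m" "q \<in> ?I i" by blast
      have z: "q \<in> ?I j \<longleftrightarrow> j = i" for j
        using disj i by blast
      have "a \<le> t i" "t (Suc i) \<le> b"
        using incseqD[OF t(1), of 0 i] incseqD[OF t(1), of "Suc i" m] i t by auto
      then have "q \<in> {a..b}" using i by auto
      moreover have "(\<Sum>j<m. indicator (?I j) q *\<^sub>R U j) = (\<Sum>j<m. if j = i then U j else 0)"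
        by (intro sum.cong) (auto simp: indicator_def z simp del: greaterThanAtMost_iff)
      moreover have "(\<Sum>j<m. ennreal ((norm (U j))\<^sup>2) * indicator (?I j) q) = (\<Sum>j<m. if j = i then ennreal ((norm (U j))\<^sup>2) else 0)"
        by (intro sum.cong) (auto simp: indicator_def z simp del: greaterThanAtMost_iff)
      ultimately show ?thesis
        unfolding op functional_norm_sq_inner using i(1) by simp
    next
      case False
      then have "indicator (?I j) q = (0::real)" "indicator (?I j) q = (0::ennreal)" if "j < m" for j
        using that by (auto simp: indicator_def)
      then show ?thesis
        unfolding op functional_norm_sq_inner by simp
    qed
    have "(\<integral>\<^sup>+q\<in>{a..b}. functional_norm_sq (\<lambda>v. Re (c * step_op G q v k)) \<partial>lborel)
        = (\<Sum>j<m. \<integral>\<^sup>+q. ennreal ((norm (U j))\<^sup>2) * indicator (?I j) q \<partial>lborel)"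
      unfolding pt by (rule nn_integral_sum) measurable
    also have "\<dots> = (\<Sum>j<m. ennreal ((norm (U j))\<^sup>2) * emeasure lborel (?I j))"
      by (intro sum.cong refl nn_integral_cmult_indicator) simp
    also have "\<dots> = (\<Sum>j<m. ennreal ((t (Suc j) - t j) * (norm (U j))\<^sup>2))"
      using incseqD[OF t(1)] by (intro sum.cong) (auto simp: ennreal_mult mult.commute)
    also have "\<dots> = ennreal V"
      unfolding V_def using incseqD[OF t(1)] by (intro sum_ennreal) (auto intro!: mult_nonneg_nonneg)
    finally show ?thesis .
  qed
  show thesis
  proof (rule that[OF _ \<zeta>_AE _ var])
    show "\<zeta> \<in> borel_measurable (F b)"
      using grid_measurable[OF t(1), where m = m and U = U] t ab by (simp add: \<zeta>_def[abs_def])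
    show "V \<ge> 0"
      unfolding V_def using incseqD[OF t(1)] by (intro sum_nonneg) (auto intro!: mult_nonneg_nonneg)
    show "(\<integral>\<omega>. indicator A \<omega> * iexp (\<theta> * \<zeta> \<omega>) \<partial>M) = of_real (prob A * exp (- (\<theta>\<^sup>2 * V / 2)))"
      if "A \<in> sets (F a)" for A \<theta>
      unfolding \<zeta>_def V_def using grid_char[OF t(1), where A = A and \<theta> = \<theta> and m = m and U = U] that t ab by simp
  qed
qed

end

section \<open>From step integrands to stochastic integrals\<close>

lemma sobolev_space_0: "(\<lambda>_. 0) \<in> sobolev_space s"
  by (simp add: sobolev_space_def)

lemma sobolev_space_scale:
  assumes "a \<in> sobolev_space s"
  shows "(\<lambda>k. of_real r * a k) \<in> sobolev_space s"
proof -
  have "(\<lambda>k. r\<^sup>2 * (sobolev_weight s k * (cmod (a k))\<^sup>2)) summable_on UNIV"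
    using assms by (intro summable_on_cmult_right) (simp add: sobolev_space_def)
  then show ?thesis
    using assms by (simp add: sobolev_space_def norm_mult power_mult_distrib mult_ac)
qed

lemma sobolev_space_step:
  assumes "step_integrand s a b G"
  shows "step_op G q v \<in> sobolev_space s" "step_integral W G \<omega> \<in> sobolev_space s"
proof -
  have *: "(\<lambda>k. \<Sum>(r, r', u, x)\<leftarrow>G. of_real (\<phi> r r' u) * x k) \<in> sobolev_space s" for \<phi> :: "real \<Rightarrow> real \<Rightarrow> 'a \<Rightarrow> real"
    using assms
  proof (induction G)
    case Nil
    then show ?case by (simp add: sobolev_space_0)
  next
    case (Cons p G)
    obtain r r' u x where p: "p = (r, r', u, x)" by (cases p)
    have "x \<in> sobolev_space s" "step_integrand s a b G"
      using Cons.prems by (auto simp: p step_integrand_def)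
    then show ?case
      using sobolev_space_add[OF sobolev_space_scale[of x s "\<phi> r r' u"] Cons.IH] by (simp add: p)
  qed
  show "step_op G q v \<in> sobolev_space s"
    using *[of "\<lambda>r r' u. indicator {r<..r'} q * (v \<bullet> u)"] by (simp add: step_op_def[abs_def])
  show "step_integral W G \<omega> \<in> sobolev_space s"
    using *[of "\<lambda>r r' u. W r' u \<omega> - W r u \<omega>"] by (simp add: step_integral_def[abs_def])
qed

lemma Re_step_op:
  "Re (c * step_op G q v k) = (\<Sum>(r, r', u, x)\<leftarrow>G. indicator {r<..r'} q * (Re (c * x k) * (v \<bullet> u)))"
  unfolding step_op_def by (induction G) (auto simp: algebra_simps)

lemma bounded_linear_Re_step_op: "bounded_linear (\<lambda>v. Re (c * step_op G q v k))"
  unfolding Re_step_op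
  by (induction G) (auto intro!: bounded_linear_add bounded_linear_const_mult bounded_linear_inner_left)

lemma borel_measurable_Re_step_op: "(\<lambda>q. Re (c * step_op G q v k)) \<in> borel_measurable borel"
  unfolding Re_step_op by (induction G) (auto split: prod.split)

lemma sobolev_dist_ge_coeff:
  assumes "a \<in> sobolev_space s" "b \<in> sobolev_space s" "norm c = 1"
  shows "sobolev_weight s k * (Re (c * a k) - Re (c * b k))\<^sup>2 \<le> (sobolev_dist s a b)\<^sup>2"
proof -
  have "\<bar>Re (c * (a k - b k))\<bar> \<le> cmod (a k - b k)"
    using abs_Re_le_cmod[of "c * (a k - b k)"] assms(3) by (simp only: norm_mult)
  then have "(Re (c * a k) - Re (c * b k))\<^sup>2 \<le> (cmod (a k - b k))\<^sup>2"
    unfolding right_diff_distrib minus_complex.sel(1)[symmetric] abs_le_square_iff[symmetric] by simp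
  then show ?thesis
    using sobolev_coeff_le_norm[OF sobolev_space_diff[OF assms(1,2)], of k]
    unfolding sobolev_dist_def by (meson mult_left_mono order_trans sobolev_weight_nonneg)
qed

lemma tendsto_zero_if_cmult_le:
  fixes f g :: "nat \<Rightarrow> ennreal"
  assumes g: "g \<longlonglongrightarrow> 0" and w: "w > 0" and le: "\<And>n. ennreal w * f n \<le> g n"
  shows "f \<longlonglongrightarrow> 0"
proof (rule tendsto_sandwich[OF _ _ tendsto_const])
  show "(\<lambda>n. ennreal (1 / w) * g n) \<longlonglongrightarrow> 0"
    using ennreal_tendsto_cmult[OF _ g, of "ennreal (1 / w)"] by simp
  have "f n = ennreal (1 / w) * (ennreal w * f n)" for n
    using w by (simp add: mult.assoc[symmetric] flip: ennreal_mult)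
  then show "\<forall>\<^sub>F n in sequentially. f n \<le> ennreal (1 / w) * g n"
    using le by (intro always_eventually allI) (metis mult_left_mono zero_le)
qed simp

context cylindrical_wiener_space
begin

text \<open>The characteristic identity passes to the limit along step integrands, and
  \<open>V\<close> is a subsequential limit of their variances. Two-sided comparison with
  \<open>J\<close> up to the factor 2 of \<open>functional_norm_sq_add_le\<close> suffices: later
  only \<open>V = 0\<close> when \<open>J = 0\<close>, the bound V \<ge> J / 2 and finiteness of
  \<open>J\<close> matter.\<close>

lemma stochastic_integral_coeff_gaussian:
  fixes B :: "real \<Rightarrow> 'u \<Rightarrow> coeffs" and c :: complex
  assumes I: "is_stochastic_integral M W s a b B I" and ab: "0 \<le> a" "a \<le> b" and c: "norm c = 1"
    and B: "\<And>q u. q \<in> {a..b} \<Longrightarrow> B q u \<in> sobolev_space s"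
    and bl: "\<And>q. bounded_linear (\<lambda>u. Re (c * B q u k))"
    and meas: "\<And>u. (\<lambda>q. Re (c * B q u k)) \<in> borel_measurable borel"
    and bd: "\<And>q. q \<in> {a..b} \<Longrightarrow> functional_norm_sq (\<lambda>u. Re (c * B q u k)) \<le> ennreal K"
  defines "J \<equiv> \<integral>\<^sup>+q\<in>{a..b}. functional_norm_sq (\<lambda>u. Re (c * B q u k)) \<partial>lborel"
  obtains \<eta> V where "\<eta> \<in> borel_measurable (F b)" "AE \<omega> in M. \<eta> \<omega> = Re (c * I \<omega> k)"
    and "V \<ge> 0" "ennreal V \<le> 2 * J" "J \<le> 2 * ennreal V"
    and "\<And>A \<theta>. A \<in> sets (F a) \<Longrightarrow>
       (\<integral>\<omega>. indicator A \<omega> * iexp (\<theta> * \<eta> \<omega>) \<partial>M) = of_real (prob A * exp (- (\<theta>\<^sup>2 * V / 2)))"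
proof -
  define w where "w = sobolev_weight s k"
  have w: "w > 0" by (simp add: w_def sobolev_weight_pos)
  obtain G where G: "\<And>n. step_integrand s a b (G n)"
    and G1: "(\<lambda>n. \<integral>\<^sup>+r\<in>{a..b}. hs_norm_sq s (\<lambda>u k. step_op (G n) r u k - B r u k) \<partial>lborel) \<longlonglongrightarrow> 0"
    and G2: "(\<lambda>n. \<integral>\<^sup>+\<omega>. ennreal ((sobolev_dist s (step_integral W (G n) \<omega>) (I \<omega>))\<^sup>2) \<partial>M) \<longlonglongrightarrow> 0"
    using I unfolding is_stochastic_integral_def by blast
  have IM: "I \<in> M \<rightarrow>\<^sub>M sobolev_borel s"
    using I by (simp add: is_stochastic_integral_def)
  define \<xi> where "\<xi> \<omega> = Re (c * I \<omega> k)" for \<omega>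
  have \<xi>[measurable]: "\<xi> \<in> borel_measurable M"
    unfolding \<xi>_def[abs_def] using measurable_compose[OF IM measurable_sobolev_coeff[of k s]] by measurable

  define gauss where "gauss n \<zeta> V \<longleftrightarrow>
    \<zeta> \<in> borel_measurable (F b) \<and> (AE \<omega> in M. \<zeta> \<omega> = Re (c * step_integral W (G n) \<omega> k)) \<and> V \<ge> 0 \<and>
    (\<integral>\<^sup>+q\<in>{a..b}. functional_norm_sq (\<lambda>v. Re (c * step_op (G n) q v k)) \<partial>lborel) = ennreal V \<and>
    (\<forall>A \<theta>. A \<in> sets (F a) \<longrightarrow>
       (\<integral>\<omega>. indicator A \<omega> * iexp (\<theta> * \<zeta> \<omega>) \<partial>M) = of_real (prob A * exp (- (\<theta>\<^sup>2 * V / 2))))"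
    for n \<zeta> and V :: real
  have "\<exists>\<zeta> V. gauss n \<zeta> V" for n
    unfolding gauss_def by (rule step_integral_gaussian[OF G[of n] ab, of c k]) blast
  then obtain \<zeta> V where gauss: "\<And>n. gauss n (\<zeta> n) (V n)"
    by metis
  have \<zeta>F: "\<And>n. \<zeta> n \<in> borel_measurable (F b)"
    and \<zeta>_AE: "\<And>n. AE \<omega> in M. \<zeta> n \<omega> = Re (c * step_integral W (G n) \<omega> k)"
    and V: "\<And>n. V n \<ge> 0"
    and var: "\<And>n. (\<integral>\<^sup>+q\<in>{a..b}. functional_norm_sq (\<lambda>v. Re (c * step_op (G n) q v k)) \<partial>lborel) = ennreal (V n)"
    and char: "\<And>n A \<theta>. A \<in> sets (F a) \<Longrightarrow>
       (\<integral>\<omega>. indicator A \<omega> * iexp (\<theta> * \<zeta> n \<omega>) \<partial>M) = of_real (prob A * exp (- (\<theta>\<^sup>2 * V n / 2)))"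
    using gauss unfolding gauss_def by blast+
  have \<zeta>[measurable]: "\<zeta> n \<in> borel_measurable M" for n
    using measurable_F[OF \<zeta>F] ab by simp

  let ?\<beta> = "\<lambda>q u. Re (c * B q u k)"
  let ?\<gamma> = "\<lambda>n q u. Re (c * step_op (G n) q u k)"
  let ?\<delta> = "\<lambda>n q u. Re (c * (step_op (G n) q u k - B q u k))"
  have \<delta>: "?\<delta> n q u = ?\<gamma> n q u - ?\<beta> q u" for n q u
    by (simp add: right_diff_distrib)
  have bl\<delta>: "bounded_linear (?\<delta> n q)" for n q
    unfolding \<delta> by (intro bounded_linear_sub bounded_linear_Re_step_op bl)
  have m\<beta>[measurable]: "(\<lambda>q. functional_norm_sq (?\<beta> q)) \<in> borel_measurable borel"
    by (rule borel_measurable_functional_norm_sq[OF bl meas])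
  have m\<gamma>[measurable]: "(\<lambda>q. functional_norm_sq (?\<gamma> n q)) \<in> borel_measurable borel" for n
    by (rule borel_measurable_functional_norm_sq[OF bounded_linear_Re_step_op borel_measurable_Re_step_op])
  have m\<delta>[measurable]: "(\<lambda>q. functional_norm_sq (?\<delta> n q)) \<in> borel_measurable borel" for n
    by (rule borel_measurable_functional_norm_sq[OF bl\<delta>])
       (unfold \<delta>, intro borel_measurable_diff borel_measurable_Re_step_op meas)
  define D where "D n = (\<integral>\<^sup>+q\<in>{a..b}. functional_norm_sq (?\<delta> n q) \<partial>lborel)" for n
  have D: "D \<longlonglongrightarrow> 0"
  proof (rule tendsto_zero_if_cmult_le[OF G1 w])
    fix n
    have "ennreal w * D n = (\<integral>\<^sup>+q. ennreal w * (functional_norm_sq (?\<delta> n q) * indicator {a..b} q) \<partial>lborel)"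
      unfolding D_def by (rule nn_integral_cmult[symmetric]) measurable
    also have "\<dots> \<le> (\<integral>\<^sup>+q\<in>{a..b}. hs_norm_sq s (\<lambda>u k. step_op (G n) q u k - B q u k) \<partial>lborel)"
    proof (rule nn_integral_mono)
      fix q :: real
      have "ennreal w * functional_norm_sq (?\<delta> n q) \<le> hs_norm_sq s (\<lambda>u k. step_op (G n) q u k - B q u k)"
        if "q \<in> {a..b}"
        unfolding w_def
        by (rule functional_norm_sq_le_hs_norm_sq[where T = "\<lambda>u k. step_op (G n) q u k - B q u k", OF _ c bl\<delta>])
           (intro sobolev_space_diff sobolev_space_step(1)[OF G] B that)
      then show "ennreal w * (functional_norm_sq (?\<delta> n q) * indicator {a..b} q)
          \<le> hs_norm_sq s (\<lambda>u k. step_op (G n) q u k - B q u k) * indicator {a..b} q"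
        by (auto simp: indicator_def)
    qed
    finally show "ennreal w * D n \<le> \<dots>" .
  qed
  have int_add: "(\<integral>\<^sup>+q\<in>{a..b}. f q \<partial>lborel) \<le> 2 * (\<integral>\<^sup>+q\<in>{a..b}. g q \<partial>lborel) + 2 * (\<integral>\<^sup>+q\<in>{a..b}. e q \<partial>lborel)"
    if le: "\<And>q. f q \<le> 2 * g q + 2 * e q" and [measurable]: "g \<in> borel_measurable borel" "e \<in> borel_measurable borel"
    for f g e :: "real \<Rightarrow> ennreal"
  proof -
    have "(\<integral>\<^sup>+q\<in>{a..b}. f q \<partial>lborel) \<le> (\<integral>\<^sup>+q. 2 * (g q * indicator {a..b} q) + 2 * (e q * indicator {a..b} q) \<partial>lborel)"
      using le by (intro nn_integral_mono) (auto simp: indicator_def)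
    also have "\<dots> = 2 * (\<integral>\<^sup>+q\<in>{a..b}. g q \<partial>lborel) + 2 * (\<integral>\<^sup>+q\<in>{a..b}. e q \<partial>lborel)"
      by (simp add: nn_integral_add nn_integral_cmult)
    finally show ?thesis .
  qed
  have VJ: "ennreal (V n) \<le> 2 * J + 2 * D n" for n
    unfolding var[symmetric] J_def D_def
  proof (rule int_add[OF _ m\<beta> m\<delta>])
    show "functional_norm_sq (?\<gamma> n q) \<le> 2 * functional_norm_sq (?\<beta> q) + 2 * functional_norm_sq (?\<delta> n q)" for q
      by (rule functional_norm_sq_add_le) (simp add: algebra_simps)
  qed
  have JV: "J \<le> 2 * ennreal (V n) + 2 * D n" for n
    unfolding var[symmetric] J_def D_def
  proof (rule int_add[OF _ m\<gamma> m\<delta>])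
    show "functional_norm_sq (?\<beta> q) \<le> 2 * functional_norm_sq (?\<gamma> n q) + 2 * functional_norm_sq (?\<delta> n q)" for q
      unfolding functional_norm_sq_uminus[of "?\<delta> n q", symmetric]
      by (rule functional_norm_sq_add_le) (simp add: algebra_simps)
  qed
  \<comment> \<open>Finiteness of \<open>J\<close> bounds the variances of the approximations and so
    yields a convergent subsequence of them.\<close>
  have "J \<le> (\<integral>\<^sup>+q. ennreal K * indicator {a..b} q \<partial>lborel)"
    unfolding J_def using bd by (intro nn_integral_mono) (auto simp: indicator_def)
  also have "\<dots> < \<infinity>"
    using ab by (simp add: nn_integral_cmult_indicator ennreal_mult_less_top)
  finally have J: "J < \<infinity>" .

  define Q where "Q n = (\<integral>\<^sup>+\<omega>. ennreal ((\<zeta> n \<omega> - \<xi> \<omega>)\<^sup>2) \<partial>M)" for n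
  have Q: "Q \<longlonglongrightarrow> 0"
  proof (rule tendsto_zero_if_cmult_le[OF G2 w])
    fix n
    have "ennreal w * Q n = (\<integral>\<^sup>+\<omega>. ennreal w * ennreal ((\<zeta> n \<omega> - \<xi> \<omega>)\<^sup>2) \<partial>M)"
      unfolding Q_def by (rule nn_integral_cmult[symmetric]) measurable
    also have "\<dots> \<le> (\<integral>\<^sup>+\<omega>. ennreal ((sobolev_dist s (step_integral W (G n) \<omega>) (I \<omega>))\<^sup>2) \<partial>M)"
    proof (rule nn_integral_mono_AE)
      show "AE \<omega> in M. ennreal w * ennreal ((\<zeta> n \<omega> - \<xi> \<omega>)\<^sup>2) \<le> ennreal ((sobolev_dist s (step_integral W (G n) \<omega>) (I \<omega>))\<^sup>2)"
        using \<zeta>_AE[of n] AE_space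
      proof eventually_elim
        case (elim \<omega>)
        have "I \<omega> \<in> sobolev_space s"
          using measurable_space[OF IM elim(2)] by (simp add: space_sobolev_borel)
        from sobolev_dist_ge_coeff[OF sobolev_space_step(2)[OF G[of n], of W \<omega>] this c, of k]
        show ?case
          using w unfolding elim(1) \<xi>_def w_def by (simp add: ennreal_leI flip: ennreal_mult)
      qed
    qed
    finally show "ennreal w * Q n \<le> \<dots>" .
  qed
  \<comment> \<open>From \<open>N\<close> on the mean squares \<open>Q n\<close> are finite, as
    integrability demands, and the errors \<open>D n\<close> are below 1, as the variance bound
    demands; hence the shift by \<open>N\<close>.\<close>
  obtain N where N: "\<And>n. n \<ge> N \<Longrightarrow> D n < 1 \<and> Q n < 1"
    using eventually_conj[OF order_tendstoD(2)[OF D, of 1] order_tendstoD(2)[OF Q, of 1]]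
    by (auto simp: eventually_sequentially)
  have u: "integrable M (\<lambda>\<omega>. (\<zeta> (n + N) \<omega> - \<xi> \<omega>)\<^sup>2)" for n
    using N[of "n + N"] by (intro integrableI_bounded) (auto simp: Q_def intro: less_trans)
  have "(\<lambda>n. \<integral>\<omega>. norm ((\<zeta> (n + N) \<omega> - \<xi> \<omega>)\<^sup>2) \<partial>M) \<longlonglongrightarrow> 0"
  proof -
    have "(\<integral>\<omega>. norm ((\<zeta> (n + N) \<omega> - \<xi> \<omega>)\<^sup>2) \<partial>M) = enn2real (Q (n + N))" for n
      unfolding Q_def by (subst integral_eq_nn_integral) auto
    moreover have "(\<lambda>n. enn2real (Q (n + N))) \<longlonglongrightarrow> 0"
      using LIMSEQ_ignore_initial_segment[OF Q, of N] tendsto_enn2real[of "\<lambda>n. Q (n + N)" 0 sequentially] by simp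
    ultimately show ?thesis by simp
  qed
  from tendsto_L1_AE_subseq[OF u this] obtain r where r: "strict_mono r"
    and r_AE: "AE \<omega> in M. (\<lambda>n. (\<zeta> (r n + N) \<omega> - \<xi> \<omega>)\<^sup>2) \<longlonglongrightarrow> 0" by auto
  have "V (r n + N) \<le> 2 * enn2real J + 2" for n
  proof -
    have "ennreal (V (r n + N)) \<le> 2 * J + 2 * 1"
      using VJ[of "r n + N"] N[of "r n + N"]
      by (elim order_trans) (intro add_mono mult_left_mono, auto)
    also have "\<dots> = ennreal (2 * enn2real J + 2)"
      using J by (simp add: ennreal_plus ennreal_mult)
    finally show ?thesis by (subst (asm) ennreal_le_iff) auto
  qed
  then have "bounded (range (\<lambda>n. V (r n + N)))"
    using V by (intro boundedI[where B = "2 * enn2real J + 2"]) auto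
  then obtain v l where l: "strict_mono l" and lim: "((\<lambda>n. V (r n + N)) \<circ> l) \<longlonglongrightarrow> v"
    using bounded_imp_convergent_subsequence by blast
  \<comment> \<open>A single index sequence along which the modes converge almost surely and their
    variances converge too.\<close>
  define f where "f n = r (l n) + N" for n
  have f: "filterlim f at_top sequentially"
    using l r by (intro filterlim_subseq) (auto simp: f_def strict_mono_def)
  have Vf: "(\<lambda>n. V (f n)) \<longlonglongrightarrow> v"
    using lim by (simp add: f_def o_def)
  have Df: "(\<lambda>n. D (f n)) \<longlonglongrightarrow> 0"
    by (rule filterlim_compose[OF D f])
  have \<zeta>f: "AE \<omega> in M. (\<lambda>n. \<zeta> (f n) \<omega>) \<longlonglongrightarrow> \<xi> \<omega>"
    using r_AE
  proof eventually_elim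
    case (elim \<omega>)
    from LIMSEQ_subseq_LIMSEQ[OF this l] have "(\<lambda>n. (\<zeta> (f n) \<omega> - \<xi> \<omega>)\<^sup>2) \<longlonglongrightarrow> 0"
      by (simp add: f_def o_def)
    from tendsto_real_sqrt[OF this] have "(\<lambda>n. \<bar>\<zeta> (f n) \<omega> - \<xi> \<omega>\<bar>) \<longlonglongrightarrow> 0"
      by simp
    then show ?case
      by (simp add: tendsto_rabs_zero_iff LIM_zero_iff)
  qed
  \<comment> \<open>The limit \<xi> is known to be measurable only for \<open>M\<close>; taking
    \<open>lim\<close> of the adapted approximations gives a version measurable at time
    \<open>b\<close>.\<close>
  define \<eta> where "\<eta> \<omega> = lim (\<lambda>n. \<zeta> (f n) \<omega>)" for \<omega>
  have \<eta>F: "\<eta> \<in> borel_measurable (F b)"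
    unfolding \<eta>_def[abs_def] by (intro borel_measurable_lim_metric \<zeta>F)
  have \<eta>_AE: "AE \<omega> in M. \<eta> \<omega> = \<xi> \<omega>"
    using \<zeta>f by eventually_elim (simp add: \<eta>_def limI)
  show thesis
  proof (rule that[OF \<eta>F \<eta>_AE[unfolded \<xi>_def]])
    show "v \<ge> 0"
      using Vf V by (intro LIMSEQ_le_const) auto
    show "ennreal v \<le> 2 * J"
    proof (rule LIMSEQ_le)
      show "(\<lambda>n. ennreal (V (f n))) \<longlonglongrightarrow> ennreal v" using Vf by (rule tendsto_ennrealI)
      have "(\<lambda>n. 2 * J + 2 * D (f n)) \<longlonglongrightarrow> 2 * J + 2 * 0"
        by (intro tendsto_add tendsto_const ennreal_tendsto_cmult Df) auto
      then show "(\<lambda>n. 2 * J + 2 * D (f n)) \<longlonglongrightarrow> 2 * J" by simp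
    qed (use VJ in auto)
    show "J \<le> 2 * ennreal v"
    proof (rule LIMSEQ_le[OF tendsto_const])
      have "(\<lambda>n. 2 * ennreal (V (f n)) + 2 * D (f n)) \<longlonglongrightarrow> 2 * ennreal v + 2 * 0"
        by (intro tendsto_add ennreal_tendsto_cmult Df tendsto_ennrealI Vf) auto
      then show "(\<lambda>n. 2 * ennreal (V (f n)) + 2 * D (f n)) \<longlonglongrightarrow> 2 * ennreal v" by simp
    qed (use JV in auto)
    fix A \<theta> assume A: "A \<in> sets (F a)"
    then have [measurable]: "A \<in> events" using sets_F_subset ab by blast
    have [measurable]: "\<eta> \<in> borel_measurable M" using measurable_F[OF \<eta>F] ab by simp
    have "(\<lambda>n. \<integral>\<omega>. indicator A \<omega> * iexp (\<theta> * \<zeta> (f n) \<omega>) \<partial>M) \<longlonglongrightarrow> (\<integral>\<omega>. indicator A \<omega> * iexp (\<theta> * \<eta> \<omega>) \<partial>M)"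
    proof (rule integral_dominated_convergence[where w = "\<lambda>_. 1"])
      show "AE \<omega> in M. (\<lambda>n. indicator A \<omega> * iexp (\<theta> * \<zeta> (f n) \<omega>)) \<longlonglongrightarrow> indicator A \<omega> * iexp (\<theta> * \<eta> \<omega>)"
        using \<zeta>f \<eta>_AE by eventually_elim (auto intro!: tendsto_intros)
    qed (auto simp: norm_mult indicator_def)
    moreover have "(\<lambda>n. complex_of_real (prob A * exp (- (\<theta>\<^sup>2 * V (f n) / 2)))) \<longlonglongrightarrow> of_real (prob A * exp (- (\<theta>\<^sup>2 * v / 2)))"
      by (intro tendsto_intros Vf) auto
    ultimately show "(\<integral>\<omega>. indicator A \<omega> * iexp (\<theta> * \<eta> \<omega>) \<partial>M) = of_real (prob A * exp (- (\<theta>\<^sup>2 * v / 2)))"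
      unfolding char[OF A] by (rule LIMSEQ_unique)
  qed
qed

end

text \<open>Conditioning on \<open>A\<close> turns the hypothesis into the characteristic function
  of a probability law, and Levy's uniqueness theorem identifies it. Writing the law as
  \<open>sqrt V\<close> times a standard normal variable includes the degenerate case
  \<open>V = 0\<close>.\<close>

lemma (in prob_space) conditional_gaussian_law:
  assumes \<eta>[measurable]: "\<eta> \<in> borel_measurable M" and A[measurable]: "A \<in> events" and B[measurable]: "B \<in> sets borel"
    and V: "V \<ge> 0"
    and char: "\<And>\<theta>. (\<integral>\<omega>. indicator A \<omega> * iexp (\<theta> * \<eta> \<omega>) \<partial>M) = of_real (prob A * exp (- (\<theta>\<^sup>2 * V / 2)))"
  shows "prob (A \<inter> (\<eta> -` B \<inter> space M)) = prob A * measure std_normal_distribution {x. sqrt V * x \<in> B}"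
proof (cases "prob A = 0")
  case True
  then have "prob (A \<inter> (\<eta> -` B \<inter> space M)) \<le> 0"
    using finite_measure_mono[of "A \<inter> (\<eta> -` B \<inter> space M)" A] by simp
  with True show ?thesis by (simp add: measure_le_0_iff)
next
  case False
  define N where "N = uniform_measure M A"
  have eA: "emeasure M A \<noteq> 0" "emeasure M A \<noteq> \<infinity>"
    using False by (auto simp: emeasure_eq_measure)
  interpret N: prob_space N
    unfolding N_def by (rule prob_space_uniform_measure[OF eA])
  interpret S: real_distribution std_normal_distribution by (rule real_dist_normal_dist)
  have \<eta>N: "\<eta> \<in> borel_measurable N" by (simp add: N_def)
  have "distr N borel \<eta> = distr std_normal_distribution borel (\<lambda>x. sqrt V * x)"
  proof (rule Levy_uniqueness)
    show "real_distribution (distr N borel \<eta>)" by (rule N.real_distribution_distr[OF \<eta>N])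
    show "real_distribution (distr std_normal_distribution borel (\<lambda>x. sqrt V * x))"
      by (rule S.real_distribution_distr) simp
    have N_density: "N = density M (\<lambda>\<omega>. ennreal (indicator A \<omega> / prob A))"
      unfolding N_def uniform_measure_def
      using False by (intro density_cong) (auto simp: emeasure_eq_measure divide_ennreal indicator_def zero_less_measure_iff
          simp flip: ennreal_1)
    show "Characteristic_Functions.char (distr N borel \<eta>)
        = Characteristic_Functions.char (distr std_normal_distribution borel (\<lambda>x. sqrt V * x))"
    proof
      fix \<theta>
      have "Characteristic_Functions.char (distr N borel \<eta>) \<theta> = (\<integral>\<omega>. iexp (\<theta> * \<eta> \<omega>) \<partial>N)"
        unfolding char_def by (subst integral_distr[OF \<eta>N]) auto
      also have "\<dots> = (\<integral>\<omega>. (indicator A \<omega> / prob A) *\<^sub>R iexp (\<theta> * \<eta> \<omega>) \<partial>M)"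
        unfolding N_density by (rule integral_density) auto
      also have "\<dots> = (\<integral>\<omega>. of_real (1 / prob A) * (indicator A \<omega> * iexp (\<theta> * \<eta> \<omega>)) \<partial>M)"
        by (intro Bochner_Integration.integral_cong) (auto simp: indicator_def scaleR_conv_of_real)
      also have "\<dots> = of_real (1 / prob A) * of_real (prob A * exp (- (\<theta>\<^sup>2 * V / 2)))"
        unfolding char[symmetric] by (rule integral_mult_right_zero)
      also have "\<dots> = of_real (exp (- ((\<theta> * sqrt V)\<^sup>2) / 2))"
        using False V by (simp add: power_mult_distrib)
      also have "\<dots> = Characteristic_Functions.char std_normal_distribution (\<theta> * sqrt V)"
        by (simp add: char_std_normal_distribution)
      also have "\<dots> = Characteristic_Functions.char (distr std_normal_distribution borel (\<lambda>x. sqrt V * x)) \<theta>"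
        unfolding char_def by (subst integral_distr) (auto simp: mult_ac)
      finally show "Characteristic_Functions.char (distr N borel \<eta>) \<theta> = \<dots>" .
    qed
  qed
  then have "measure (distr N borel \<eta>) B = measure (distr std_normal_distribution borel (\<lambda>x. sqrt V * x)) B"
    by simp
  also have "measure (distr N borel \<eta>) B = prob (A \<inter> (\<eta> -` B \<inter> space M)) / prob A"
    using \<eta>N by (subst measure_distr) (auto simp: N_def eA measure_uniform_measure)
  also have "measure (distr std_normal_distribution borel (\<lambda>x. sqrt V * x)) B = measure std_normal_distribution {x. sqrt V * x \<in> B}"
    by (subst measure_distr) (auto simp: vimage_def)
  finally show ?thesis using False by (simp add: field_simps)
qed

text \<open>The density is positive everywhere, so full mass on [-R, R] would make an interval of
  length 1 beyond |R| a Lebesgue null set.\<close>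

lemma std_normal_bounded_interval_less_1: "measure std_normal_distribution {x. \<bar>x\<bar> \<le> R} < 1"
proof -
  interpret S: real_distribution std_normal_distribution by (rule real_dist_normal_dist)
  have "measure std_normal_distribution {x. \<bar>x\<bar> \<le> R} \<noteq> 1"
  proof
    assume "measure std_normal_distribution {x. \<bar>x\<bar> \<le> R} = 1"
    then have "AE x in std_normal_distribution. x \<in> {x. \<bar>x\<bar> \<le> R}"
      by (intro S.AE_prob_1) simp
    then have "AE x in lborel. \<bar>x\<bar> \<le> R"
      by (subst (asm) AE_density) (auto simp: normal_density_pos)
    then have "emeasure lborel {x. \<not> \<bar>x\<bar> \<le> R} = 0"
      by (subst (asm) AE_iff_measurable[OF _ refl]) auto
    moreover have "emeasure lborel {\<bar>R\<bar><..<\<bar>R\<bar> + 1} \<le> emeasure lborel {x. \<not> \<bar>x\<bar> \<le> R}"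
      by (intro emeasure_mono) auto
    ultimately show False by simp
  qed
  then show ?thesis using S.prob_le_1[of "{x. \<bar>x\<bar> \<le> R}"] by linarith
qed

context cylindrical_wiener_space
begin

text \<open>The event that the increments so far stay below \<open>C\<close> belongs to the past of
  the next one, so each further increment multiplies its probability by at most \<open>q\<close> <
  1. Joint independence of the whole sequence is never formed.\<close>

lemma independent_gaussians_unbounded:
  assumes h: "h > 0" and v: "v > 0"
    and \<eta>: "\<And>N. \<eta> N \<in> borel_measurable (F (real N * h + h))"
    and V: "\<And>N. V N \<ge> v"
    and char: "\<And>N A \<theta>. A \<in> sets (F (real N * h)) \<Longrightarrow>
       (\<integral>\<omega>. indicator A \<omega> * iexp (\<theta> * \<eta> N \<omega>) \<partial>M) = of_real (prob A * exp (- (\<theta>\<^sup>2 * V N / 2)))"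
  shows "AE \<omega> in M. \<exists>N. \<bar>\<eta> (Suc N) \<omega>\<bar> > C"
proof -
  \<comment> \<open>The lower bound \<open>v\<close> on the variances makes \<open>q\<close> the
    same for all steps; |C| accommodates negative \<open>C\<close>.\<close>
  define q where "q = measure std_normal_distribution {x. \<bar>x\<bar> \<le> \<bar>C\<bar> / sqrt v}"
  have q: "0 \<le> q" "q < 1"
    by (auto simp: q_def std_normal_bounded_interval_less_1)
  \<comment> \<open>These are increments 1 to \<open>N\<close>, which end at time (N + 1) h, exactly
    where increment N + 1 begins.\<close>
  define B where "B N = {\<omega> \<in> space M. \<forall>j<N. \<bar>\<eta> (Suc j) \<omega>\<bar> \<le> C}" for N
  have Bm: "B N \<in> sets (F (real (Suc N) * h))" for N
  proof -
    define T where "T = real (Suc N) * h"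
    have T: "0 \<le> T" using h by (simp add: T_def)
    have m: "\<eta> (Suc j) \<in> borel_measurable (F T)" if "j < N" for j
    proof (rule measurable_F_mono[OF \<eta>])
      show "real (Suc j) * h + h \<le> T"
        using mult_right_mono[of "real (Suc j)" "real N" h] that h by (simp add: T_def algebra_simps)
    qed (use h in simp)
    have "{\<omega> \<in> space (F T). \<forall>j\<in>{..<N}. \<bar>\<eta> (Suc j) \<omega>\<bar> \<le> C} \<in> sets (F T)"
      by (intro sets.sets_Collect_finite_All borel_measurable_le borel_measurable_abs borel_measurable_const m) auto
    then show ?thesis unfolding space_F[OF T] by (simp only: B_def T_def Ball_def lessThan_iff)
  qed
  have Bev: "B N \<in> events" for N
    using Bm[of N] sets_F_subset[of "real (Suc N) * h"] h by auto
  have step: "prob (B (Suc N)) \<le> prob (B N) * q" for N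
  proof -
    have V0: "V (Suc N) > 0" using V[of "Suc N"] v by simp
    have "prob (B (Suc N)) = prob (B N \<inter> (\<eta> (Suc N) -` {x. \<bar>x\<bar> \<le> C} \<inter> space M))"
      by (rule arg_cong[where f = prob]) (auto simp: B_def less_Suc_eq)
    also have "\<dots> = prob (B N) * measure std_normal_distribution {x. sqrt (V (Suc N)) * x \<in> {x. \<bar>x\<bar> \<le> C}}"
      using V0 h
      by (intro conditional_gaussian_law char Bm Bev measurable_F[OF \<eta>]) auto
    also have "\<dots> \<le> prob (B N) * q"
    proof (intro mult_left_mono)
      interpret S: real_distribution std_normal_distribution by (rule real_dist_normal_dist)
      have "\<bar>x\<bar> \<le> \<bar>C\<bar> / sqrt v" if "\<bar>sqrt (V (Suc N)) * x\<bar> \<le> C" for x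
      proof -
        have "sqrt v * \<bar>x\<bar> \<le> sqrt (V (Suc N)) * \<bar>x\<bar>"
          using V by (intro mult_right_mono) auto
        also have "\<dots> \<le> \<bar>C\<bar>" using that V0 by (simp add: abs_mult)
        finally show ?thesis using v by (simp add: pos_le_divide_eq mult.commute)
      qed
      then show "measure std_normal_distribution {x. sqrt (V (Suc N)) * x \<in> {x. \<bar>x\<bar> \<le> C}} \<le> q"
        unfolding q_def by (intro S.finite_measure_mono) auto
    qed simp
    finally show ?thesis .
  qed
  have pow: "prob (B N) \<le> q ^ N" for N
  proof (induction N)
    case (Suc N)
    have "prob (B (Suc N)) \<le> prob (B N) * q" by (rule step)
    also have "\<dots> \<le> q ^ N * q" using Suc q by (intro mult_right_mono) auto
    finally show ?case by (simp add: mult.commute)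
  qed simp
  have "prob (\<Inter>N. B N) \<le> 0"
  proof (rule LIMSEQ_le_const)
    show "(\<lambda>N. q ^ N) \<longlonglongrightarrow> 0" using q by (intro LIMSEQ_realpow_zero) auto
    have "prob (\<Inter>N. B N) \<le> q ^ N" for N
      using finite_measure_mono[of "\<Inter>N. B N" "B N"] Bev pow[of N] by (meson INT_lower UNIV_I order_trans)
    then show "\<exists>N. \<forall>n\<ge>N. prob (\<Inter>N. B N) \<le> q ^ n" by blast
  qed
  then have "(\<Inter>N. B N) \<in> null_sets M"
    using Bev by (intro null_setsI) (auto simp: emeasure_eq_measure measure_le_0_iff)
  then have "AE \<omega> in M. \<omega> \<notin> (\<Inter>N. B N)" by (rule AE_not_in)
  with AE_space show ?thesis
    by eventually_elim (auto simp: B_def not_le)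
qed

end

section \<open>Almost sure breakdown\<close>

lemma airy_semigroup_space:
  assumes "lam \<ge> 0" "t \<ge> 0" and a: "a \<in> sobolev_space s"
  shows "airy_semigroup lam t a \<in> sobolev_space s"
proof -
  have "airy_semigroup lam t a (- k) = cnj (airy_semigroup lam t a k)" for k
    using sobolev_symmetric[OF a, of k] by (simp add: airy_semigroup_def exp_cnj power3_eq_cube)
  moreover have "(\<lambda>k. sobolev_weight s k * (cmod (airy_semigroup lam t a k))\<^sup>2) summable_on UNIV"
  proof (rule summable_on_comparison_test)
    show "(\<lambda>k. sobolev_weight s k * (cmod (a k))\<^sup>2) summable_on UNIV"
      using a by (simp add: sobolev_space_def)
    show "sobolev_weight s k * (cmod (airy_semigroup lam t a k))\<^sup>2 \<le> sobolev_weight s k * (cmod (a k))\<^sup>2" for k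
      using airy_semigroup_norm_le[OF assms(1,2), of a k] by (intro mult_left_mono power_mono) auto
  qed simp
  ultimately show ?thesis by (simp add: sobolev_space_def)
qed

lemma sobolev_coeff_norm_le:
  assumes "a \<in> sobolev_space s"
  shows "cmod (a k) \<le> sobolev_norm s a / sqrt (sobolev_weight s k)"
proof -
  have "(sqrt (sobolev_weight s k) * cmod (a k))\<^sup>2 \<le> (sobolev_norm s a)\<^sup>2"
    using sobolev_coeff_le_norm[OF assms, of k]
    by (simp only: power_mult_distrib real_sqrt_pow2 sobolev_weight_nonneg)
  then have "sqrt (sobolev_weight s k) * cmod (a k) \<le> sobolev_norm s a"
    by (rule power2_le_imp_le) simp
  then show ?thesis
    using sobolev_weight_pos[of s k] by (simp add: pos_le_divide_eq mult.commute)
qed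

lemma hilbert_schmidt_coeff_bounded:
  assumes "hilbert_schmidt s \<Phi>"
  obtains K where "K \<ge> 0" "\<And>u. cmod (\<Phi> u k) \<le> K * norm u"
proof -
  obtain C where C: "\<And>u. sobolev_norm s (\<Phi> u) \<le> C * norm u" and sp: "\<And>u. \<Phi> u \<in> sobolev_space s"
    using assms by (auto simp: hilbert_schmidt_def)
  have "cmod (\<Phi> u k) \<le> \<bar>C\<bar> / sqrt (sobolev_weight s k) * norm u" for u
  proof -
    have "cmod (\<Phi> u k) \<le> sobolev_norm s (\<Phi> u) / sqrt (sobolev_weight s k)"
      by (rule sobolev_coeff_norm_le[OF sp])
    also have "\<dots> \<le> \<bar>C\<bar> * norm u / sqrt (sobolev_weight s k)"
    proof (rule divide_right_mono)
      show "sobolev_norm s (\<Phi> u) \<le> \<bar>C\<bar> * norm u"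
        using C[of u] mult_right_mono[OF abs_ge_self norm_ge_zero, of C u] by linarith
    qed simp
    finally show ?thesis by simp
  qed
  then show thesis by (intro that[of "\<bar>C\<bar> / sqrt (sobolev_weight s k)"]) auto
qed

lemma hilbert_schmidt_coeff_bounded_linear:
  assumes hs: "hilbert_schmidt s \<Phi>"
  shows "bounded_linear (\<lambda>u. \<Phi> u k)"
proof -
  have lin: "\<Phi> (c *\<^sub>R u + v) k = of_real c * \<Phi> u k + \<Phi> v k" for c u v
    using hs by (simp add: hilbert_schmidt_def)
  have 0: "\<Phi> 0 k = 0" using lin[of 1 0 0] by simp
  obtain K where "\<And>u. cmod (\<Phi> u k) \<le> K * norm u"
    by (rule hilbert_schmidt_coeff_bounded[OF hs]) blast
  then show ?thesis
  proof (intro bounded_linear_intro[where K = K])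
    show "\<Phi> (u + v) k = \<Phi> u k + \<Phi> v k" for u v using lin[of 1 u v] by simp
    show "\<Phi> (r *\<^sub>R u) k = r *\<^sub>R \<Phi> u k" for r u
      using lin[of r u 0] 0 by (simp add: scaleR_conv_of_real)
  qed (simp add: mult.commute)
qed

lemma fourier_fun_const:
  assumes "\<And>k. k \<noteq> 0 \<Longrightarrow> a k = 0"
  shows "fourier_fun a = (\<lambda>_. fourier_fun a 0)"
proof
  fix x
  have "a k * cis (real_of_int k * x) = a k * cis (real_of_int k * 0)" for k
    using assms[of k] by (cases "k = 0") auto
  then show "fourier_fun a x = fourier_fun a 0"
    unfolding fourier_fun_def by (simp only:)
qed

context cylindrical_wiener_space
begin

text \<open>Otherwise almost every realisation has only its zeroth mode and is constant in x, so its
  derivative vanishes, already at \<open>x = 0\<close>, and the infimum is 0.\<close>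

lemma nondegenerate_mode:
  assumes "(INF x. \<integral>\<^sup>+\<omega>. ennreal (\<bar>deriv (fourier_fun (Z \<omega>)) x\<bar>\<^sup>2) \<partial>M) > 0"
  obtains k c where "k \<noteq> 0" "norm c = 1" "\<not> (AE \<omega> in M. Re (c * Z \<omega> k) = 0)"
proof (rule ccontr)
  assume "\<not> thesis"
  with that have *: "AE \<omega> in M. Re (c * Z \<omega> k) = 0" if "k \<noteq> 0" "norm c = 1" for k c
    using that by blast
  have "AE \<omega> in M. k \<noteq> 0 \<longrightarrow> Z \<omega> k = 0" for k
  proof (cases "k = 0")
    case False
    \<comment> \<open>The factors 1 and -i extract the real and the imaginary part of the
      mode.\<close>
    have "AE \<omega> in M. Re (1 * Z \<omega> k) = 0" "AE \<omega> in M. Re (- \<i> * Z \<omega> k) = 0"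
      by (rule *[OF False], simp)+
    then show ?thesis
      by eventually_elim (simp add: complex_eq_iff)
  qed simp
  then have "AE \<omega> in M. \<forall>k. k \<noteq> 0 \<longrightarrow> Z \<omega> k = 0"
    by (simp add: AE_all_countable)
  then have "AE \<omega> in M. ennreal (\<bar>deriv (fourier_fun (Z \<omega>)) 0\<bar>\<^sup>2) = 0"
  proof eventually_elim
    case (elim \<omega>)
    then have "fourier_fun (Z \<omega>) = (\<lambda>_. fourier_fun (Z \<omega>) 0)"
      by (intro fourier_fun_const) blast
    then have "deriv (fourier_fun (Z \<omega>)) 0 = 0"
      by (metis deriv_const)
    then show ?case by simp
  qed
  then have "(\<integral>\<^sup>+\<omega>. ennreal (\<bar>deriv (fourier_fun (Z \<omega>)) 0\<bar>\<^sup>2) \<partial>M) = (\<integral>\<^sup>+\<omega>. 0 \<partial>M)"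
    by (rule nn_integral_cong_AE)
  then have "(INF x. \<integral>\<^sup>+\<omega>. ennreal (\<bar>deriv (fourier_fun (Z \<omega>)) x\<bar>\<^sup>2) \<partial>M) \<le> 0"
    by (intro INF_lower2[of 0]) auto
  with assms show False by simp
qed

text \<open>Nondegeneracy is assumed for the first increment only. It reaches all others through
  \<open>J N\<close>, which does not depend on \<open>N\<close> and is comparable to each
  variance.\<close>

lemma airy_convolution_coeff_unbounded:
  assumes h: "h > 0" and lam: "lam \<ge> 0" and hs: "hilbert_schmidt s \<Phi>"
    and Z: "\<And>N. is_airy_convolution M W s lam \<Phi> (real N * h) h (Z N)"
    and c: "norm c = 1" and nondeg: "\<not> (AE \<omega> in M. Re (c * Z 0 \<omega> k) = 0)"
  shows "AE \<omega> in M. \<exists>N. cmod (Z (Suc N) \<omega> k) > C"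
proof -
  define B where "B N q u = airy_semigroup lam (real N * h + h - q) (\<Phi> u)" for N :: nat and q u
  define J where "J N = (\<integral>\<^sup>+q\<in>{real N * h..real N * h + h}. functional_norm_sq (\<lambda>u. Re (c * B N q u k)) \<partial>lborel)" for N
  have sp: "\<Phi> u \<in> sobolev_space s" for u
    using hs by (simp add: hilbert_schmidt_def)
  have BS: "B N q u \<in> sobolev_space s" if "q \<in> {real N * h..real N * h + h}" for N q u
    unfolding B_def using that lam sp by (intro airy_semigroup_space) auto
  have bl: "bounded_linear (\<lambda>u. Re (c * B N q u k))" for N q
    unfolding B_def airy_semigroup_def
    by (intro bounded_linear_compose[OF bounded_linear_Re] bounded_linear_const_mult hilbert_schmidt_coeff_bounded_linear[OF hs])
  have meas: "(\<lambda>q. Re (c * B N q u k)) \<in> borel_measurable borel" for N u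
    unfolding B_def airy_semigroup_def
    by (intro borel_measurable_continuous_onI continuous_intros)
  have m: "(\<lambda>q. functional_norm_sq (\<lambda>u. Re (c * B N q u k))) \<in> borel_measurable borel" for N
    by (rule borel_measurable_functional_norm_sq[OF bl meas])
  obtain K where K: "K \<ge> 0" "\<And>u. cmod (\<Phi> u k) \<le> K * norm u"
    by (rule hilbert_schmidt_coeff_bounded[OF hs]) blast
  have bd: "functional_norm_sq (\<lambda>u. Re (c * B N q u k)) \<le> ennreal (K\<^sup>2)"
    if q: "q \<in> {real N * h..real N * h + h}" for N q
  proof (rule functional_norm_sq_le_if_dense[OF bl closure_UNIV])
    fix u
    have "\<bar>Re (c * B N q u k)\<bar> \<le> cmod (B N q u k)"
      using abs_Re_le_cmod[of "c * B N q u k"] c by (simp only: norm_mult)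
    also have "\<dots> \<le> cmod (\<Phi> u k)"
      unfolding B_def using q lam by (intro airy_semigroup_norm_le) auto
    also have "\<dots> \<le> K * norm u" by (rule K)
    finally have "\<bar>Re (c * B N q u k)\<bar>\<^sup>2 \<le> (K * norm u)\<^sup>2"
      by (intro power_mono) auto
    then show "(Re (c * B N q u k))\<^sup>2 \<le> K\<^sup>2 * (norm u)\<^sup>2"
      by (simp only: power_mult_distrib power2_abs)
  qed simp
  \<comment> \<open>The integrand depends on time only through the time left to the end of the step,
    so a translation by N h identifies the integrals.\<close>
  have J_eq: "J N = J 0" for N
  proof -
    have "J N = (\<integral>\<^sup>+q. functional_norm_sq (\<lambda>u. Re (c * B N (real N * h + 1 * q) u k))
        * indicator {real N * h..real N * h + h} (real N * h + 1 * q) \<partial>lborel)"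
      unfolding J_def using m by (subst nn_integral_real_affine[where c = 1 and t = "real N * h"]) auto
    also have "\<dots> = J 0"
      unfolding J_def by (intro nn_integral_cong) (auto simp: B_def indicator_def)
    finally show ?thesis .
  qed
  define gauss where "gauss N \<eta> V \<longleftrightarrow>
      \<eta> \<in> borel_measurable (F (real N * h + h)) \<and> (AE \<omega> in M. \<eta> \<omega> = Re (c * Z N \<omega> k)) \<and>
      V \<ge> 0 \<and> ennreal V \<le> 2 * J 0 \<and> J 0 \<le> 2 * ennreal V \<and>
      (\<forall>A \<theta>. A \<in> sets (F (real N * h)) \<longrightarrow>
       (\<integral>\<omega>. indicator A \<omega> * iexp (\<theta> * \<eta> \<omega>) \<partial>M) = of_real (prob A * exp (- (\<theta>\<^sup>2 * V / 2))))"
    for N \<eta> and V :: real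
  have "\<exists>\<eta> V. gauss N \<eta> V" for N
  proof -
    have I: "is_stochastic_integral M W s (real N * h) (real N * h + h) (B N) (Z N)"
      using Z[of N] by (simp add: is_airy_convolution_def B_def[abs_def])
    have h0: "0 \<le> real N * h" "real N * h \<le> real N * h + h"
      using h by auto
    note L = stochastic_integral_coeff_gaussian[OF I h0 c BS bl meas bd, folded J_def]
    show ?thesis
    proof (rule L, assumption)
      fix \<eta> V
      assume "\<eta> \<in> borel_measurable (F (real N * h + h))" "AE \<omega> in M. \<eta> \<omega> = Re (c * Z N \<omega> k)"
        and "V \<ge> 0" "ennreal V \<le> 2 * J N" "J N \<le> 2 * ennreal V"
        and "\<And>A \<theta>. A \<in> sets (F (real N * h)) \<Longrightarrow>
          (\<integral>\<omega>. indicator A \<omega> * iexp (\<theta> * \<eta> \<omega>) \<partial>M) = of_real (prob A * exp (- (\<theta>\<^sup>2 * V / 2)))"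
      then have "gauss N \<eta> V"
        unfolding gauss_def J_eq[of N, symmetric] by (intro conjI allI impI)
      then show ?thesis by blast
    qed
  qed
  then obtain \<eta> V where gauss: "\<And>N. gauss N (\<eta> N) (V N)" by metis
  have \<eta>: "\<And>N. \<eta> N \<in> borel_measurable (F (real N * h + h))"
    and \<eta>_AE: "\<And>N. AE \<omega> in M. \<eta> N \<omega> = Re (c * Z N \<omega> k)"
    and V: "\<And>N. V N \<ge> 0" "\<And>N. ennreal (V N) \<le> 2 * J 0" "\<And>N. J 0 \<le> 2 * ennreal (V N)"
    and char: "\<And>N A \<theta>. A \<in> sets (F (real N * h)) \<Longrightarrow>
       (\<integral>\<omega>. indicator A \<omega> * iexp (\<theta> * \<eta> N \<omega>) \<partial>M) = of_real (prob A * exp (- (\<theta>\<^sup>2 * V N / 2)))"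
    using gauss unfolding gauss_def by blast+
  have \<eta>M: "\<eta> N \<in> borel_measurable M" for N
    using measurable_F[OF \<eta>] h by simp
  \<comment> \<open>If it were 0, the variance of the first increment would vanish and the mode
    would be almost surely 0, against \<open>nondeg\<close>.\<close>
  have "J 0 \<noteq> 0"
  proof
    assume "J 0 = 0"
    then have "V 0 = 0" using V(1,2)[of 0] by simp
    have \<Omega>: "space M \<in> sets (F (real 0 * h))"
      using sets.top[of "F (real 0 * h)"] by (simp add: space_F)
    interpret S: real_distribution std_normal_distribution by (rule real_dist_normal_dist)
    have "prob (space M \<inter> (\<eta> 0 -` {0} \<inter> space M)) = prob (space M) * measure std_normal_distribution {x. sqrt (V 0) * x \<in> {0}}"
      by (rule conditional_gaussian_law[OF \<eta>M _ _ V(1) char[OF \<Omega>]]) auto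
    then have "prob (\<eta> 0 -` {0} \<inter> space M) = 1"
      using S.prob_space by (simp add: \<open>V 0 = 0\<close> prob_space Int_commute Int_left_commute)
    then have "AE \<omega> in M. \<omega> \<in> \<eta> 0 -` {0} \<inter> space M"
      by (rule AE_prob_1)
    with \<eta>_AE[of 0] have "AE \<omega> in M. Re (c * Z 0 \<omega> k) = 0"
      by eventually_elim simp
    with nondeg show False by blast
  qed
  moreover have "J 0 < \<infinity>"
    using V(3)[of 0] by (rule order_le_less_trans) (simp add: ennreal_mult_less_top)
  ultimately have Jpos: "enn2real (J 0) > 0" and J: "J 0 = ennreal (enn2real (J 0))"
    by (simp_all add: enn2real_positive_iff zero_less_iff_neq_zero)
  have "AE \<omega> in M. \<exists>N. \<bar>\<eta> (Suc N) \<omega>\<bar> > C"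
  proof (rule independent_gaussians_unbounded[OF h _ \<eta> _ char])
    \<comment> \<open>The uniform lower bound for the variances: half of \<open>J 0\<close>, from J
      \<le> 2 V.\<close>
    show "enn2real (J 0) / 2 > 0" using Jpos by simp
    show "V N \<ge> enn2real (J 0) / 2" for N
    proof -
      have "ennreal (enn2real (J 0)) \<le> ennreal (2 * V N)"
        using V(3)[of N] V(1)[of N] unfolding J[symmetric] by (simp add: ennreal_mult)
      then show ?thesis using V(1)[of N] by (simp add: ennreal_le_iff)
    qed
  qed
  moreover have "AE \<omega> in M. \<forall>N. \<eta> N \<omega> = Re (c * Z N \<omega> k)"
    using \<eta>_AE by (simp add: AE_all_countable)
  ultimately show ?thesis
  proof eventually_elim
    case (elim \<omega>)
    then obtain N where "\<bar>Re (c * Z (Suc N) \<omega> k)\<bar> > C" by auto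
    moreover have "\<bar>Re (c * Z (Suc N) \<omega> k)\<bar> \<le> cmod (Z (Suc N) \<omega> k)"
      using abs_Re_le_cmod[of "c * Z (Suc N) \<omega> k"] c by (simp only: norm_mult)
    ultimately show ?case by (intro exI[of _ N]) linarith
  qed
qed

end

theorem theorem2p3:
  fixes M :: "'w measure"
    and F :: "real \<Rightarrow> 'w measure"
    and W :: "real \<Rightarrow> 'u::{real_inner, polish_space} \<Rightarrow> 'w \<Rightarrow> real"
    and \<Phi> :: "'u \<Rightarrow> coeffs"
    and V0 :: "'w \<Rightarrow> coeffs"
    and Z :: "nat \<Rightarrow> 'w \<Rightarrow> coeffs"
    and h lam \<sigma> s :: real
  assumes "h > 0" and "lam > 0" and "\<sigma> > 3 / 2"
    and "usual_filtered_prob_space M F"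
    and "cylindrical_wiener M F W"
    and "hilbert_schmidt s \<Phi>"
    and "V0 \<in> F 0 \<rightarrow>\<^sub>M sobolev_borel \<sigma>"
    and "\<And>N. is_airy_convolution M W s lam \<Phi> (real N * h) h (Z N)"
    and "AE \<omega> in M. Z 0 \<omega> \<in> sobolev_space \<sigma>"
    and "(INF x. \<integral>\<^sup>+\<omega>. ennreal (\<bar>deriv (fourier_fun (Z 0 \<omega>)) x\<bar>\<^sup>2) \<partial>M) > 0"
  shows "(AE \<omega> in M. \<exists>N. breaks_down_at \<sigma> h lam (\<lambda>n. Z n \<omega>) (V0 \<omega>) N) \<and>
         (AE \<omega> in M. \<exists>N. \<forall>n>N. lie_trotter \<sigma> h lam (\<lambda>n. Z n \<omega>) (V0 \<omega>) n = None)"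
proof -
  interpret cylindrical_wiener_space M F W
    using assms(4,5) by (rule cylindrical_wiener_space.intro)
  obtain k c where k: "k \<noteq> 0" and c: "norm c = 1" and nondeg: "\<not> (AE \<omega> in M. Re (c * Z 0 \<omega> k) = 0)"
    using nondegenerate_mode[OF assms(10)] by blast
  have "AE \<omega> in M. \<exists>N. cmod (Z (Suc N) \<omega> k) > 2 / h"
    using airy_convolution_coeff_unbounded[OF assms(1) _ assms(6,8) c nondeg] assms(2) by simp
  then have breakdown: "AE \<omega> in M. \<exists>N. breaks_down_at \<sigma> h lam (\<lambda>n. Z n \<omega>) (V0 \<omega>) N"
  proof eventually_elim
    case (elim \<omega>)
    then show ?case
      using noise_coeff_le_if_no_breakdown[OF assms(3,1) _ k, of lam "\<lambda>n. Z n \<omega>" "V0 \<omega>"] assms(2)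
      by (force simp: not_le[symmetric])
  qed
  moreover from this have "AE \<omega> in M. \<exists>N. \<forall>n>N. lie_trotter \<sigma> h lam (\<lambda>n. Z n \<omega>) (V0 \<omega>) n = None"
    by eventually_elim (blast intro: lie_trotter_None_after_breakdown)
  ultimately show ?thesis by blast
qed

end
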